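(* Let $\mathbf{OpPerLC}$ be the category of all locally compact Hausdorff spaces and all open perfect maps between them. Let $\mathbf{DOpPerLC}$ be the category whose objects are all complete local contact algebras and whose morphisms $\varphi:(A,\rho,\mathbb{B})\to(B,\eta,\mathbb{B}')$ are all complete Boolean homomorphisms $\varphi:A\to B$ satisfying (L1) for all $a,b\in A$, $\varphi(a)\,\eta\,\varphi(b)$ implies $a\,\rho\,b$; (L2) $b\in\mathbb{B}'$ implies $\varphi_\Lambda(b)\in\mathbb{B}$; (L3) $a\in\mathbb{B}$ implies $\varphi(a)\in\mathbb{B}'$; and (LO) for all $a\in A$ and all $b\in\mathbb{B}'$, $\varphi_\Lambda(b)\,\rho\,a$ implies $b\,\eta\,\varphi(a)$. Then the categories $\mathbf{OpPerLC}$ and $\mathbf{DOpPerLC}$ are dually equivalent.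
   Context: Open maps are assumed to be continuous. A map is perfect if it is continuous, closed, and all its point inverses are compact. Maps are not assumed to be onto. A contact algebra $(B,C)$ is a Boolean algebra $B=(B,0,1,\vee,\wedge,{}^* )$ ($0=1$ is allowed; $^*$ is complement) with a binary relation $C$ on $B$ such that: (C1) $a\neq 0$ implies $aCa$; (C2) $aCb$ implies $a\ne 0$ and $b\neq 0$; (C3) $aCb$ implies $bCa$; (C4) $aC(b\vee c)$ iff $aCb$ or $aCc$. Write $a\ll_C b$ iff not $aCb^*$. A local contact algebra $(B,\rho,\mathbb{B})$ consists of a contact algebra $(B,\rho)$ and an ideal $\mathbb{B}$ of $B$ (possibly non-proper) such that: (BC1) if $a\in\mathbb{B}$, $c\in B$ and $a\ll_\rho c$ then $a\ll_\rho b\ll_\rho c$ for some $b\in\mathbb{B}$; (BC2) if $a\rho b$ then there is $c\in\mathbb{B}$ with $a\rho(c\wedge b)$; (BC3) if $a\ne 0$ then there is $b\in\mathbb{B}\setminus\{0\}$ with $b\ll_\rho a$. It is complete if $B$ is a complete Boolean algebra. A complete Boolean homomorphism is one preserving all joins and meets. For such $\varphi:A\to B$, $\varphi_\Lambda:B\to A$ denotes its left adjoint: $b\le\varphi(a)$ iff $\varphi_\Lambda(b)\le a$. Composition of morphisms is composition of functions. Two categories are dually equivalent if one is equivalent to the opposite of the other. *)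

theory Defs
  imports "HOL-Analysis.Analysis" "HOL-Algebra.Complete_Lattice" "HOL-Library.Equipollence"
begin

section \<open>Categories, functors and dual equivalence\<close>

text \<open>Categories are presented by hom-sets. \<open>Comp C X Y Z g f\<close> is the composite of
  \<open>f \<in> Hom C X Y\<close> followed by \<open>g \<in> Hom C Y Z\<close>. Hom-sets of different pairs of objects
  need not be disjoint.\<close>

record ('o, 'm) cat =
  Obj :: "'o set"
  Hom :: "'o \<Rightarrow> 'o \<Rightarrow> 'm set"
  Id :: "'o \<Rightarrow> 'm"
  Comp :: "'o \<Rightarrow> 'o \<Rightarrow> 'o \<Rightarrow> 'm \<Rightarrow> 'm \<Rightarrow> 'm"

locale category =
  fixes C :: "('o, 'm) cat"
  assumes Id_in_Hom: "X \<in> Obj C \<Longrightarrow> Id C X \<in> Hom C X X"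
    and Comp_in_Hom:
      "\<lbrakk>X \<in> Obj C; Y \<in> Obj C; Z \<in> Obj C; f \<in> Hom C X Y; g \<in> Hom C Y Z\<rbrakk>
        \<Longrightarrow> Comp C X Y Z g f \<in> Hom C X Z"
    and Comp_Id_right:
      "\<lbrakk>X \<in> Obj C; Y \<in> Obj C; f \<in> Hom C X Y\<rbrakk> \<Longrightarrow> Comp C X X Y f (Id C X) = f"
    and Comp_Id_left:
      "\<lbrakk>X \<in> Obj C; Y \<in> Obj C; f \<in> Hom C X Y\<rbrakk> \<Longrightarrow> Comp C X Y Y (Id C Y) f = f"
    and Comp_assoc:
      "\<lbrakk>W \<in> Obj C; X \<in> Obj C; Y \<in> Obj C; Z \<in> Obj C;
        f \<in> Hom C W X; g \<in> Hom C X Y; h \<in> Hom C Y Z\<rbrakk>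
        \<Longrightarrow> Comp C W Y Z h (Comp C W X Y g f) = Comp C W X Z (Comp C X Y Z h g) f"

definition opposite :: "('o, 'm) cat \<Rightarrow> ('o, 'm) cat" where
  "opposite C = \<lparr>Obj = Obj C, Hom = (\<lambda>X Y. Hom C Y X), Id = Id C,
                 Comp = (\<lambda>X Y Z g f. Comp C Z Y X f g)\<rparr>"

definition full_subcategory :: "('o, 'm) cat \<Rightarrow> 'o set \<Rightarrow> ('o, 'm) cat" where
  "full_subcategory C S = C\<lparr>Obj := Obj C \<inter> S\<rparr>"

definition isomorphisms :: "('o, 'm) cat \<Rightarrow> 'o \<Rightarrow> 'o \<Rightarrow> 'm set" where
  "isomorphisms C X Y = {f \<in> Hom C X Y. \<exists>g \<in> Hom C Y X.
     Comp C X Y X g f = Id C X \<and> Comp C Y X Y f g = Id C Y}"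

record ('o, 'm, 'p, 'n) func =
  fobj :: "'o \<Rightarrow> 'p"
  fmor :: "'o \<Rightarrow> 'o \<Rightarrow> 'm \<Rightarrow> 'n"

definition is_functor ::
  "('o, 'm) cat \<Rightarrow> ('p, 'n) cat \<Rightarrow> ('o, 'm, 'p, 'n) func \<Rightarrow> bool" where
  "is_functor C D F \<longleftrightarrow>
     (\<forall>X \<in> Obj C. fobj F X \<in> Obj D) \<and>
     (\<forall>X \<in> Obj C. \<forall>Y \<in> Obj C. \<forall>f \<in> Hom C X Y.
        fmor F X Y f \<in> Hom D (fobj F X) (fobj F Y)) \<and>
     (\<forall>X \<in> Obj C. fmor F X X (Id C X) = Id D (fobj F X)) \<and>
     (\<forall>X \<in> Obj C. \<forall>Y \<in> Obj C. \<forall>Z \<in> Obj C. \<forall>f \<in> Hom C X Y. \<forall>g \<in> Hom C Y Z.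
        fmor F X Z (Comp C X Y Z g f) =
        Comp D (fobj F X) (fobj F Y) (fobj F Z) (fmor F Y Z g) (fmor F X Y f))"

definition id_func :: "('o, 'm, 'o, 'm) func" where
  "id_func = \<lparr>fobj = (\<lambda>X. X), fmor = (\<lambda>X Y f. f)\<rparr>"

definition comp_func ::
  "('p, 'n, 'q, 'k) func \<Rightarrow> ('o, 'm, 'p, 'n) func \<Rightarrow> ('o, 'm, 'q, 'k) func" where
  "comp_func G F = \<lparr>fobj = (\<lambda>X. fobj G (fobj F X)),
                    fmor = (\<lambda>X Y f. fmor G (fobj F X) (fobj F Y) (fmor F X Y f))\<rparr>"

definition naturally_isomorphic ::
  "('o, 'm) cat \<Rightarrow> ('p, 'n) cat \<Rightarrow> ('o, 'm, 'p, 'n) func \<Rightarrow> ('o, 'm, 'p, 'n) func \<Rightarrow> bool" where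
  "naturally_isomorphic C D F G \<longleftrightarrow>
     (\<exists>\<eta>. (\<forall>X \<in> Obj C. \<eta> X \<in> isomorphisms D (fobj F X) (fobj G X)) \<and>
          (\<forall>X \<in> Obj C. \<forall>Y \<in> Obj C. \<forall>f \<in> Hom C X Y.
             Comp D (fobj F X) (fobj F Y) (fobj G Y) (\<eta> Y) (fmor F X Y f) =
             Comp D (fobj F X) (fobj G X) (fobj G Y) (fmor G X Y f) (\<eta> X)))"

definition equivalent :: "('o, 'm) cat \<Rightarrow> ('p, 'n) cat \<Rightarrow> bool" where
  "equivalent C D \<longleftrightarrow> category C \<and> category D \<and>
     (\<exists>F G. is_functor C D F \<and> is_functor D C G \<and>
            naturally_isomorphic C C (comp_func G F) id_func \<and>
            naturally_isomorphic D D (comp_func F G) id_func)"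

definition dually_equivalent :: "('o, 'm) cat \<Rightarrow> ('p, 'n) cat \<Rightarrow> bool" where
  "dually_equivalent C D \<longleftrightarrow> equivalent C (opposite D)"


section \<open>Smallness\<close>

text \<open>A set-theoretic category of ``all'' structures becomes, in HOL, the category of all
  structures whose carrier belongs to a given collection \<open>\<U>\<close> of subsets of a type.
  A universe is such a collection that is closed, up to injections, under subsets and power
  sets. For example, if \<open>'u\<close> is a type carrying a model of ZFC, then the collection of
  extensions of its elements is a universe. No other closure property is needed.

  The power set condition cannot be dropped: the dual algebra of a space \<open>X\<close> consists of
  subsets of \<open>X\<close>, and the points of the dual space of an algebra \<open>A\<close> are subsets of \<open>A\<close>.
  Hence, for arbitrary types \<open>'p\<close> of points and \<open>'e\<close> of algebra elements, a duality can
  be expected between those spaces on \<open>'p\<close> whose dual fits into \<open>'e\<close> and those algebras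
  on \<open>'e\<close> whose dual fits into \<open>'p\<close>. For \<open>'e = 'p set\<close> these are all the spaces on
  \<open>'p\<close>, for \<open>'p = 'e set\<close> all the algebras on \<open>'e\<close>.\<close>

definition small_universe :: "'u set set \<Rightarrow> bool" where
  "small_universe \<U> \<longleftrightarrow>
     (\<forall>S \<in> \<U>. \<forall>T. T \<lesssim> S \<longrightarrow> T \<in> \<U>) \<and>
     (\<forall>S \<in> \<U>. \<exists>T \<in> \<U>. Pow S \<lesssim> T)"


section \<open>Locally compact Hausdorff spaces and open perfect maps\<close>

text \<open>Perfect maps are not assumed to be onto, so they are not the library's
  \<^const>\<open>perfect_map\<close>, which is surjective by definition. A proper map in the
  sense of \<^const>\<open>proper_map\<close> is a closed map, not necessarily continuous, with compact
  point inverses. Morphisms are functions made extensional on their domain, so that equality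
  of functions is equality of morphisms.\<close>

definition open_perfect_map :: "'a topology \<Rightarrow> 'b topology \<Rightarrow> ('a \<Rightarrow> 'b) \<Rightarrow> bool" where
  "open_perfect_map X Y f \<longleftrightarrow> continuous_map X Y f \<and> open_map X Y f \<and> proper_map X Y f"

definition OpPerLC :: "'a set set \<Rightarrow> ('a topology, 'a \<Rightarrow> 'a) cat" where
  "OpPerLC \<U> = \<lparr>
     Obj = {X. topspace X \<in> \<U> \<and> locally_compact_space X \<and> Hausdorff_space X},
     Hom = (\<lambda>X Y. {f \<in> extensional (topspace X). open_perfect_map X Y f}),
     Id = (\<lambda>X. restrict (\<lambda>x. x) (topspace X)),
     Comp = (\<lambda>X Y Z g f. compose (topspace X) g f)\<rparr>"


section \<open>Complete local contact algebras\<close>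

text \<open>A Boolean algebra is a bounded distributive complemented lattice; its complement is
  determined by the order. The bottom and top elements may coincide.\<close>

locale boolean_lattice = bounded_lattice +
  assumes meet_join_distrib:
      "\<lbrakk>x \<in> carrier L; y \<in> carrier L; z \<in> carrier L\<rbrakk>
        \<Longrightarrow> x \<sqinter> (y \<squnion> z) = (x \<sqinter> y) \<squnion> (x \<sqinter> z)"
    and complement_exists:
      "x \<in> carrier L \<Longrightarrow> \<exists>y \<in> carrier L. x \<squnion> y = \<top> \<and> x \<sqinter> y = \<bottom>"

definition bcompl :: "('a, 'r) gorder_scheme \<Rightarrow> 'a \<Rightarrow> 'a" where
  "bcompl L x = (THE y. y \<in> carrier L \<and>
     x \<squnion>\<^bsub>L\<^esub> y = \<top>\<^bsub>L\<^esub> \<and> x \<sqinter>\<^bsub>L\<^esub> y = \<bottom>\<^bsub>L\<^esub>)"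

definition boolean_ideal :: "('a, 'r) gorder_scheme \<Rightarrow> 'a set \<Rightarrow> bool" where
  "boolean_ideal L I \<longleftrightarrow> I \<subseteq> carrier L \<and> \<bottom>\<^bsub>L\<^esub> \<in> I \<and>
     (\<forall>x \<in> carrier L. \<forall>y \<in> I. x \<sqsubseteq>\<^bsub>L\<^esub> y \<longrightarrow> x \<in> I) \<and>
     (\<forall>x \<in> I. \<forall>y \<in> I. x \<squnion>\<^bsub>L\<^esub> y \<in> I)"

record 'a contact_structure = "'a gorder" +
  contact :: "'a \<Rightarrow> 'a \<Rightarrow> bool"

record 'a local_contact_structure = "'a contact_structure" +
  bounded_elems :: "'a set"

locale contact_algebra = boolean_lattice +
  assumes C1: "\<lbrakk>a \<in> carrier L; a \<noteq> \<bottom>\<rbrakk> \<Longrightarrow> contact L a a"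
    and C2: "\<lbrakk>a \<in> carrier L; b \<in> carrier L; contact L a b\<rbrakk> \<Longrightarrow> a \<noteq> \<bottom> \<and> b \<noteq> \<bottom>"
    and C3: "\<lbrakk>a \<in> carrier L; b \<in> carrier L; contact L a b\<rbrakk> \<Longrightarrow> contact L b a"
    and C4: "\<lbrakk>a \<in> carrier L; b \<in> carrier L; c \<in> carrier L\<rbrakk>
              \<Longrightarrow> contact L a (b \<squnion> c) \<longleftrightarrow> contact L a b \<or> contact L a c"

definition well_inside :: "('a, 'r) contact_structure_scheme \<Rightarrow> 'a \<Rightarrow> 'a \<Rightarrow> bool" where
  "well_inside L a b \<longleftrightarrow> \<not> contact L a (bcompl L b)"

locale local_contact_algebra = contact_algebra +
  assumes bounded_ideal: "boolean_ideal L (bounded_elems L)"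
    and BC1: "\<lbrakk>a \<in> bounded_elems L; c \<in> carrier L; well_inside L a c\<rbrakk>
               \<Longrightarrow> \<exists>b \<in> bounded_elems L. well_inside L a b \<and> well_inside L b c"
    and BC2: "\<lbrakk>a \<in> carrier L; b \<in> carrier L; contact L a b\<rbrakk>
               \<Longrightarrow> \<exists>c \<in> bounded_elems L. contact L a (c \<sqinter> b)"
    and BC3: "\<lbrakk>a \<in> carrier L; a \<noteq> \<bottom>\<rbrakk>
               \<Longrightarrow> \<exists>b \<in> bounded_elems L - {\<bottom>}. well_inside L b a"

definition complete_local_contact_algebra ::
  "('a, 'r) local_contact_structure_scheme \<Rightarrow> bool" where
  "complete_local_contact_algebra L \<longleftrightarrow> local_contact_algebra L \<and> complete_lattice L"

definition complete_boolean_hom ::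
  "('a, 'r) gorder_scheme \<Rightarrow> ('b, 's) gorder_scheme \<Rightarrow> ('a \<Rightarrow> 'b) \<Rightarrow> bool" where
  "complete_boolean_hom A B \<phi> \<longleftrightarrow> \<phi> \<in> carrier A \<rightarrow> carrier B \<and>
     (\<forall>a \<in> carrier A. \<phi> (bcompl A a) = bcompl B (\<phi> a)) \<and>
     sup_pres A B \<phi> \<and> inf_pres A B \<phi>"

definition left_adjoint ::
  "('a, 'r) gorder_scheme \<Rightarrow> ('b, 's) gorder_scheme \<Rightarrow> ('a \<Rightarrow> 'b) \<Rightarrow> 'b \<Rightarrow> 'a" where
  "left_adjoint A B \<phi> b = (THE c. c \<in> carrier A \<and>
     (\<forall>a \<in> carrier A. b \<sqsubseteq>\<^bsub>B\<^esub> \<phi> a \<longleftrightarrow> c \<sqsubseteq>\<^bsub>A\<^esub> a))"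

definition DOpPerLC_morphism ::
  "('a, 'r) local_contact_structure_scheme \<Rightarrow> ('b, 's) local_contact_structure_scheme
     \<Rightarrow> ('a \<Rightarrow> 'b) \<Rightarrow> bool" where
  "DOpPerLC_morphism A B \<phi> \<longleftrightarrow> complete_boolean_hom A B \<phi> \<and>
     (\<forall>a \<in> carrier A. \<forall>b \<in> carrier A. contact B (\<phi> a) (\<phi> b) \<longrightarrow> contact A a b) \<and>
     (\<forall>b \<in> bounded_elems B. left_adjoint A B \<phi> b \<in> bounded_elems A) \<and>
     (\<forall>a \<in> bounded_elems A. \<phi> a \<in> bounded_elems B) \<and>
     (\<forall>a \<in> carrier A. \<forall>b \<in> bounded_elems B.
        contact A (left_adjoint A B \<phi> b) a \<longrightarrow> contact B b (\<phi> a))"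

definition DOpPerLC :: "'a set set \<Rightarrow> ('a local_contact_structure, 'a \<Rightarrow> 'a) cat" where
  "DOpPerLC \<U> = \<lparr>
     Obj = {A. carrier A \<in> \<U> \<and> complete_local_contact_algebra A},
     Hom = (\<lambda>A B. {\<phi> \<in> extensional (carrier A). DOpPerLC_morphism A B \<phi>}),
     Id = (\<lambda>A. restrict (\<lambda>a. a) (carrier A)),
     Comp = (\<lambda>A B C \<psi> \<phi>. compose (carrier A) \<psi> \<phi>)\<rparr>"

end

theory Submission
  imports Defs
begin

text \<open>
  The duality sends a locally compact Hausdorff space \<open>X\<close> to the complete Boolean algebra
  \<open>RC(X)\<close> of its regular closed sets, with \<open>F\<close> in contact with \<open>G\<close> when \<open>F \<inter> G \<noteq> {}\<close> and with the
  compact regular closed sets as bounded elements, and sends a map \<open>f : X \<rightarrow> Y\<close> to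
  \<open>G \<mapsto> f\<^sup>-\<^sup>1(G)\<close>. Preimages under a continuous open map commute with closure and interior, which
  makes this a complete Boolean homomorphism; if \<open>f\<close> is moreover closed, its left adjoint is the
  direct image \<open>F \<mapsto> f(F)\<close>, and the four conditions on morphisms become obvious statements about
  images and preimages. It remains to see that the functor is faithful, full and essentially
  surjective.

  \<^emph>\<open>Faithful:\<close> regular closed sets separate the points of \<open>Y\<close>.

  \<^emph>\<open>Full:\<close> let \<open>\<phi> : RC(Y) \<rightarrow> RC(X)\<close> be a morphism and \<open>x \<in> X\<close>. The regular closed sets \<open>G\<close> with
  \<open>x\<close> in the interior of \<open>\<phi>(G)\<close> form a filter base; one of them, \<open>\<phi>\<^sub>\<Lambda>(b)\<close> for a compact
  neighbourhood \<open>b\<close> of \<open>x\<close>, is compact by (L2), so they have a common point, and \<open>f(x)\<close> is chosen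
  to be such a point. By (L1), \<open>x \<in> \<phi>(G)\<close> implies \<open>f(x) \<in> G\<close>; the converse is exactly what (LO)
  gives. Hence \<open>f\<^sup>-\<^sup>1(G) = \<phi>(G)\<close>, so \<open>f\<close> is continuous, it is perfect by (L3), and it is open
  because \<open>f(x)\<close> is interior to \<open>\<phi>\<^sub>\<Lambda>(b) \<subseteq> f(b)\<close> (lemma \<open>point_map_iff\<close> and its consequences).

  \<^emph>\<open>Essentially surjective:\<close> this is Roeper's representation theorem. The points of the space
  of a complete local contact algebra \<open>A\<close> are its \<^emph>\<open>contact ends\<close>, the filters that are to become
  \<open>{a. p is interior to a}\<close>. Every ultrafilter \<open>u\<close> with a bounded element yields the contact end of
  all \<open>a\<close> such that some bounded \<open>b \<in> u\<close> is well inside \<open>a\<close>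
  (lemma \<open>contact_end_ultrafilter_end\<close>); so the Boolean prime ideal theorem provides enough ends
  (lemma \<open>contact_end_exists\<close>) and the compactness of the sets given by bounded elements (lemma
  \<open>compactin_S\<close>).

  The elements of \<open>RC(X)\<close> are sets of points while those of an object of the dual category are
  elements of a given type. The locale \<open>regular_closed_representation\<close> therefore describes an
  algebra \<open>A\<close> together with an isomorphism \<open>s\<close> of \<open>A\<close> onto \<open>RC(X)\<close>, and all statements about
  \<open>RC(X)\<close> are made about an algebra that is so represented. Then any class of spaces
  and any class of algebras in which each space represents some algebra and each algebra is
  represented by some space are dually equivalent (theorem
  \<open>dually_equivalent_if_representable\<close>); both parts of the final theorem are instances.
\<close>

(* Two notions of closure share this notation; only topological closures occur below. *)
no_notation eq_closure_of ("closure'_of\<index>")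

section \<open>Ultrafilters in Boolean lattices\<close>

context boolean_lattice
begin

lemma meet_commute: "x \<sqinter> y = y \<sqinter> x" by (rule meet_comm)

lemma meet_mono: "\<lbrakk>x \<sqsubseteq> x'; y \<sqsubseteq> y'; x \<in> carrier L; x' \<in> carrier L; y \<in> carrier L; y' \<in> carrier L\<rbrakk> \<Longrightarrow> x \<sqinter> y \<sqsubseteq> x' \<sqinter> y'"
  by (rule meet_le) (meson le_trans meet_left meet_right meet_closed)+

lemma meet_top: "x \<in> carrier L \<Longrightarrow> x \<sqinter> \<top> = x"
  using le_iff_join[of x \<top>] by simp

lemma le_bottom: "\<lbrakk>x \<in> carrier L; x \<sqsubseteq> \<bottom>\<rbrakk> \<Longrightarrow> x = \<bottom>"
  by (rule le_antisym) auto

lemma le_of_meet_eq: "\<lbrakk>x \<in> carrier L; y \<in> carrier L; x = x \<sqinter> y\<rbrakk> \<Longrightarrow> x \<sqsubseteq> y"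
  using meet_right[of x y] by simp

lemma complement_le:
  assumes "x \<in> carrier L" "y \<in> carrier L" "z \<in> carrier L" "x \<sqinter> y = \<bottom>" "y \<squnion> z = \<top>"
  shows "x \<sqsubseteq> z"
proof (rule le_of_meet_eq)
  have "x = x \<sqinter> (y \<squnion> z)" using assms by (simp add: meet_top)
  also have "\<dots> = \<bottom> \<squnion> (x \<sqinter> z)" using meet_join_distrib[of x y z] assms by (simp only: assms)
  also have "\<dots> = x \<sqinter> z" using assms le_iff_meet[of "\<bottom>" "x \<sqinter> z"] by simp
  finally show "x = x \<sqinter> z" .
qed (use assms in auto)

text \<open>Distributivity makes complements unique, so the definite description denotes one.\<close>
lemma bcompl_props:
  assumes x: "x \<in> carrier L"
  shows bcompl_closed [simp]: "bcompl L x \<in> carrier L"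
    and join_bcompl: "x \<squnion> bcompl L x = \<top>"
    and meet_bcompl: "x \<sqinter> bcompl L x = \<bottom>"
proof -
  let ?P = "\<lambda>y. y \<in> carrier L \<and> x \<squnion> y = \<top> \<and> x \<sqinter> y = \<bottom>"
  obtain y where y: "?P y" using complement_exists x by blast
  have "z = y" if "?P z" for z
    using that y x complement_le[of z x y] complement_le[of y x z]
    by (intro le_antisym) (auto simp: meet_commute[of _ x])
  then have "?P (bcompl L x)" unfolding bcompl_def using y theI[of ?P y] by blast
  then show "bcompl L x \<in> carrier L" "x \<squnion> bcompl L x = \<top>" "x \<sqinter> bcompl L x = \<bottom>" by auto
qed

lemma meet_eq_bottom_iff:
  assumes "x \<in> carrier L" "y \<in> carrier L"
  shows "x \<sqinter> y = \<bottom> \<longleftrightarrow> x \<sqsubseteq> bcompl L y"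
proof
  show "x \<sqsubseteq> bcompl L y" if "x \<sqinter> y = \<bottom>"
    using complement_le[OF _ _ _ that join_bcompl] assms by simp
  assume "x \<sqsubseteq> bcompl L y"
  then have "x \<sqinter> y \<sqsubseteq> bcompl L y \<sqinter> y" using assms by (simp add: meet_mono)
  then show "x \<sqinter> y = \<bottom>" using assms meet_bcompl[of y] by (simp add: meet_commute le_bottom)
qed

lemma bcompl_bcompl [simp]: 
  assumes "x \<in> carrier L" shows "bcompl L (bcompl L x) = x"
proof (rule le_antisym)
  show "x \<sqsubseteq> bcompl L (bcompl L x)" using assms meet_eq_bottom_iff[of x "bcompl L x"]
    by (simp add: meet_bcompl)
  have "bcompl L (bcompl L x) \<sqinter> bcompl L x = \<bottom>" using meet_bcompl[of "bcompl L x"] assms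
    by (simp add: meet_commute)
  then show "bcompl L (bcompl L x) \<sqsubseteq> x"
    using complement_le[of "bcompl L (bcompl L x)" "bcompl L x" x] join_bcompl[OF assms] assms
      by (simp add: join_comm)
qed (use assms in auto)

lemma le_iff_meet_bcompl:
  "\<lbrakk>x \<in> carrier L; y \<in> carrier L\<rbrakk> \<Longrightarrow> x \<sqsubseteq> y \<longleftrightarrow> x \<sqinter> bcompl L y = \<bottom>"
  by (simp add: meet_eq_bottom_iff)

lemma bcompl_antimono:
  "\<lbrakk>x \<sqsubseteq> y; x \<in> carrier L; y \<in> carrier L\<rbrakk> \<Longrightarrow> bcompl L y \<sqsubseteq> bcompl L x"
  using meet_eq_bottom_iff[of x "bcompl L y"] meet_eq_bottom_iff[of "bcompl L y" x]
    by (simp add: meet_commute)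

lemma bcompl_le_iff:
  "\<lbrakk>x \<in> carrier L; y \<in> carrier L\<rbrakk> \<Longrightarrow> bcompl L x \<sqsubseteq> bcompl L y \<longleftrightarrow> y \<sqsubseteq> x"
  using bcompl_antimono[of y x] bcompl_antimono[of "bcompl L x" "bcompl L y"] by auto

lemma bcompl_meet:
  assumes "x \<in> carrier L" "y \<in> carrier L" 
  shows "bcompl L (x \<sqinter> y) = bcompl L x \<squnion> bcompl L y"
proof (rule le_antisym)
  show "bcompl L x \<squnion> bcompl L y \<sqsubseteq> bcompl L (x \<sqinter> y)"
    using assms by (intro join_le) (auto simp: bcompl_le_iff meet_left meet_right)
  have "bcompl L (bcompl L x \<squnion> bcompl L y) \<sqsubseteq> x \<sqinter> y"
    using assms bcompl_antimono[OF join_left, of "bcompl L x" "bcompl L y"]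
      bcompl_antimono[OF join_right, of "bcompl L x" "bcompl L y"]
    by (intro meet_le) auto
  then show "bcompl L (x \<sqinter> y) \<sqsubseteq> bcompl L x \<squnion> bcompl L y"
    using assms bcompl_antimono[of "bcompl L (bcompl L x \<squnion> bcompl L y)" "x \<sqinter> y"] by simp
qed (use assms in auto)

lemma bcompl_join:
  assumes "x \<in> carrier L" "y \<in> carrier L" 
  shows "bcompl L (x \<squnion> y) = bcompl L x \<sqinter> bcompl L y"
  using bcompl_meet[of "bcompl L x" "bcompl L y"] assms
    by (metis bcompl_bcompl bcompl_closed join_closed meet_closed)

lemma bcompl_bottom: "bcompl L \<bottom> = \<top>"
  using join_bcompl[of \<bottom>] le_iff_meet[of \<bottom> "bcompl L \<bottom>"] by simp

definition lattice_filter :: "'a set \<Rightarrow> bool" where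
  "lattice_filter F \<longleftrightarrow> F \<subseteq> carrier L \<and> F \<noteq> {} \<and>
     (\<forall>a\<in>F. \<forall>b\<in>carrier L. a \<sqsubseteq> b \<longrightarrow> b \<in> F) \<and> (\<forall>a\<in>F. \<forall>b\<in>F. a \<sqinter> b \<in> F)"

text \<open>The filter generated by a filter and one more element.\<close>
lemma lattice_filter_insert:
  assumes F: "lattice_filter F" and a: "a \<in> carrier L"
  defines "G \<equiv> {x \<in> carrier L. \<exists>m\<in>F. m \<sqinter> a \<sqsubseteq> x}"
  shows "lattice_filter G" "F \<subseteq> G" "a \<in> G"
proof -
  have FL: "\<And>m. m \<in> F \<Longrightarrow> m \<in> carrier L" using F by (auto simp: lattice_filter_def)
  show sub: "F \<subseteq> G" using FL a meet_left unfolding G_def by blast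
  obtain m where "m \<in> F" using F by (auto simp: lattice_filter_def)
  then show "a \<in> G" using FL a meet_right[of m a] by (auto simp: G_def)
  show "lattice_filter G" unfolding lattice_filter_def
  proof (intro conjI ballI impI)
    show "G \<noteq> {}" using sub F by (auto simp: lattice_filter_def)
    show "y \<in> G" if xy: "x \<in> G" "y \<in> carrier L" "x \<sqsubseteq> y" for x y
    proof -
      obtain m where m: "m \<in> F" "m \<sqinter> a \<sqsubseteq> x" "x \<in> carrier L" using xy by (auto simp: G_def)
      then have "m \<sqinter> a \<sqsubseteq> y" using that FL a le_trans[of "m \<sqinter> a" x y] by simp
      then show ?thesis using m that by (auto simp: G_def)
    qed
    show "x \<sqinter> y \<in> G" if xy: "x \<in> G" "y \<in> G" for x y
    proof -
      obtain m where m: "m \<in> F" "m \<sqinter> a \<sqsubseteq> x" "x \<in> carrier L" using xy(1) by (auto simp: G_def)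
      obtain n where n: "n \<in> F" "n \<sqinter> a \<sqsubseteq> y" "y \<in> carrier L" using xy(2) by (auto simp: G_def)
      have mn: "m \<in> carrier L" "n \<in> carrier L" using m n FL by simp_all
      have "m \<sqinter> n \<in> F" using m n F by (simp add: lattice_filter_def)
      have "m \<sqinter> n \<sqinter> a \<sqsubseteq> m \<sqinter> a" "m \<sqinter> n \<sqinter> a \<sqsubseteq> n \<sqinter> a"
        using mn a by (simp_all add: meet_mono meet_left meet_right)
      then have "m \<sqinter> n \<sqinter> a \<sqsubseteq> x" "m \<sqinter> n \<sqinter> a \<sqsubseteq> y"
        using m n mn a le_trans[of "m \<sqinter> n \<sqinter> a" "m \<sqinter> a" x] le_trans[of "m \<sqinter> n \<sqinter> a" "n \<sqinter> a" y] by simp_all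
      then have "m \<sqinter> n \<sqinter> a \<sqsubseteq> x \<sqinter> y" using m n mn a by (simp add: meet_le)
      then show ?thesis using \<open>m \<sqinter> n \<in> F\<close> m n by (auto simp: G_def)
    qed
  qed (auto simp: G_def)
qed

definition ultrafilter :: "'a set \<Rightarrow> bool" where
  "ultrafilter u \<longleftrightarrow> lattice_filter u \<and> \<bottom> \<notin> u \<and> (\<forall>a\<in>carrier L. a \<in> u \<or> bcompl L a \<in> u)"

text \<open>The Boolean prime ideal theorem. A filter \<open>M\<close> that contains \<open>F\<close> and is maximal among those
  disjoint from \<open>I\<close> is an ultrafilter: if neither \<open>a\<close> nor its complement is in \<open>M\<close>, then adjoining
  either of them makes \<open>M\<close> meet \<open>I\<close>, so \<open>m \<sqinter> a\<close> and \<open>n \<sqinter> a\<^sup>*\<close> are in \<open>I\<close> for some \<open>m, n \<in> M\<close>;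
  hence so is \<open>m \<sqinter> n\<close>, a contradiction.\<close>
theorem ultrafilter_separation:
  assumes F: "lattice_filter F" and I: "boolean_ideal L I" and disj: "F \<inter> I = {}"
  obtains u where "ultrafilter u" "F \<subseteq> u" "u \<inter> I = {}"
proof -
  define \<G> where "\<G> = {G. lattice_filter G \<and> F \<subseteq> G \<and> G \<inter> I = {}}"
  have "\<exists>M\<in>\<G>. \<forall>X\<in>\<G>. M \<subseteq> X \<longrightarrow> X = M"
  proof (rule subset_Zorn_nonempty)
    show "\<G> \<noteq> {}" using F disj by (auto simp: \<G>_def)
    fix \<C> assume ne: "\<C> \<noteq> {}" and ch: "subset.chain \<G> \<C>"
    then have el: "lattice_filter G" "F \<subseteq> G" "G \<inter> I = {}" if "G \<in> \<C>" for G
      using that by (auto simp: \<G>_def subset.chain_def)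
    have "lattice_filter (\<Union>\<C>)" unfolding lattice_filter_def
    proof (intro conjI ballI impI)
      show "\<Union>\<C> \<subseteq> carrier L" using el(1) unfolding lattice_filter_def by (intro Union_least) blast
      show "\<Union>\<C> \<noteq> {}" using el(1) ne unfolding lattice_filter_def
        by (metis Union_upper all_not_in_conv subset_empty)
      show "b \<in> \<Union>\<C>" if "a \<in> \<Union>\<C>" "b \<in> carrier L" "a \<sqsubseteq> b" for a b
        using that el(1) unfolding lattice_filter_def by (metis Union_iff)
      show "a \<sqinter> b \<in> \<Union>\<C>" if ab: "a \<in> \<Union>\<C>" "b \<in> \<Union>\<C>" for a b
      proof -
        obtain G H where GH: "G \<in> \<C>" "H \<in> \<C>" "a \<in> G" "b \<in> H" using ab by blast
        then have "G \<subseteq> H \<or> H \<subseteq> G" using ch by (auto simp: subset.chain_def)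
        then obtain K where "K \<in> \<C>" "a \<in> K" "b \<in> K" using GH by blast
        then show ?thesis using el(1)[of K] unfolding lattice_filter_def by blast
      qed
    qed
    then show "\<Union>\<C> \<in> \<G>" using el(2,3) ne by (fastforce simp: \<G>_def)
  qed
  then obtain M where M: "lattice_filter M" "F \<subseteq> M" "M \<inter> I = {}"
    and max: "\<And>G. \<lbrakk>lattice_filter G; M \<subseteq> G; G \<inter> I = {}\<rbrakk> \<Longrightarrow> G = M"
    by (auto simp: \<G>_def)
  have MC: "\<And>m. m \<in> M \<Longrightarrow> m \<in> carrier L" using M by (auto simp: lattice_filter_def)
  have meets: "\<exists>m\<in>M. m \<sqinter> a \<in> I" if a: "a \<in> carrier L" "a \<notin> M" for a
  proof -
    note G = lattice_filter_insert[OF M(1) a(1)]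
    let ?G = "{x \<in> carrier L. \<exists>m\<in>M. m \<sqinter> a \<sqsubseteq> x}"
    have "?G \<inter> I \<noteq> {}" using max[OF G(1,2)] G(3) a(2) by auto
    then obtain x m where "x \<in> I" "m \<in> M" "m \<sqinter> a \<sqsubseteq> x" by auto
    then show ?thesis using I MC a unfolding boolean_ideal_def by (metis meet_closed)
  qed
  have "a \<in> M \<or> bcompl L a \<in> M" if a: "a \<in> carrier L" for a
  proof (rule ccontr)
    assume "\<not> ?thesis"
    then obtain m n where m: "m \<in> M" "m \<sqinter> a \<in> I" and n: "n \<in> M" "n \<sqinter> bcompl L a \<in> I"
      using meets[OF a] meets[OF bcompl_closed[OF a]] by blast
    let ?k = "m \<sqinter> n"
    have k: "m \<in> carrier L" "n \<in> carrier L" "?k \<in> carrier L" using m n MC by simp_all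
    have kM: "?k \<in> M" using m n M(1) by (simp add: lattice_filter_def)
    have "?k \<sqinter> a \<sqsubseteq> m \<sqinter> a" "?k \<sqinter> bcompl L a \<sqsubseteq> n \<sqinter> bcompl L a"
      using k a by (simp_all add: meet_mono meet_left meet_right)
    then have "?k \<sqinter> a \<in> I" "?k \<sqinter> bcompl L a \<in> I"
      using I m n k a unfolding boolean_ideal_def by (metis bcompl_closed meet_closed)+
    then have "(?k \<sqinter> a) \<squnion> (?k \<sqinter> bcompl L a) \<in> I" using I by (simp add: boolean_ideal_def)
    moreover have "(?k \<sqinter> a) \<squnion> (?k \<sqinter> bcompl L a) = ?k"
      using k a meet_join_distrib[of ?k a "bcompl L a"] by (simp add: join_bcompl meet_top)
    ultimately show False using M(3) kM by auto
  qed
  then have "ultrafilter M" using M I by (auto simp: ultrafilter_def boolean_ideal_def)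
  then show thesis using that M by blast
qed

lemma lattice_filterD:
  assumes "lattice_filter F"
  shows "a \<in> F \<Longrightarrow> a \<in> carrier L" and "\<lbrakk>a \<in> F; a \<sqsubseteq> b; b \<in> carrier L\<rbrakk> \<Longrightarrow> b \<in> F"
    and "\<lbrakk>a \<in> F; b \<in> F\<rbrakk> \<Longrightarrow> a \<sqinter> b \<in> F"
  using assms unfolding lattice_filter_def by blast+

lemma lattice_filter_principal:
  assumes "a \<in> carrier L" shows "lattice_filter {x \<in> carrier L. a \<sqsubseteq> x}"
  unfolding lattice_filter_def
proof (intro conjI ballI impI)
  show "y \<in> {x \<in> carrier L. a \<sqsubseteq> x}" if "x \<in> {x \<in> carrier L. a \<sqsubseteq> x}" "y \<in> carrier L" "x \<sqsubseteq> y" for x y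
    using that assms le_trans[of a x y] by simp
qed (use assms in \<open>auto simp: meet_le\<close>)

lemma ultrafilterD:
  assumes "ultrafilter u"
  shows "lattice_filter u" and "\<bottom> \<notin> u" and "a \<in> carrier L \<Longrightarrow> a \<notin> u \<Longrightarrow> bcompl L a \<in> u"
  using assms unfolding ultrafilter_def by blast+

end

section \<open>Regular closed sets of a locally compact Hausdorff space\<close>

definition regular_closed :: "'p topology \<Rightarrow> 'p set \<Rightarrow> bool" where
  "regular_closed X F \<longleftrightarrow> X closure_of (X interior_of F) = F"

lemma regular_closed_closedin: "regular_closed X F \<Longrightarrow> closedin X F"
  by (metis closedin_closure_of regular_closed_def)

lemma regular_closed_subset: "regular_closed X F \<Longrightarrow> F \<subseteq> topspace X"
  by (simp add: closedin_subset regular_closed_closedin)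

lemma regular_closed_closure_of_openin:
  assumes "openin X U" shows "regular_closed X (X closure_of U)"
proof -
  have "U \<subseteq> X interior_of (X closure_of U)"
    by (simp add: assms closure_of_subset interior_of_maximal openin_subset)
  then show ?thesis
    unfolding regular_closed_def
    by (metis closedin_closure_of closure_of_minimal closure_of_mono interior_of_subset subset_antisym)
qed

lemma regular_closed_subset_iff:
  assumes "regular_closed X F" "closedin X G"
  shows "F \<subseteq> G \<longleftrightarrow> X interior_of F \<subseteq> G"
  using assms by (metis closure_of_minimal interior_of_subset order_trans regular_closed_def)

text \<open>The interior of a union of two closed sets exceeds the union of their interiors by a nowhere
  dense set only; this is what makes the lattice of regular closed sets distributive.\<close>
lemma interior_of_Un_subset_closure_of_interiors:
  assumes "closedin X F" "closedin X G"
  shows "X interior_of (F \<union> G) \<subseteq> X closure_of (X interior_of F) \<union> X closure_of (X interior_of G)"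
proof -
  \<comment> \<open>The open set that has to be shown empty.\<close>
  define W where "W = X interior_of (F \<union> G) - X closure_of (X interior_of F) - X closure_of (X interior_of G)"
  have W: "openin X W" "W \<subseteq> F \<union> G"
    unfolding W_def using interior_of_subset by (fastforce intro: openin_diff)+
  have sub: "X interior_of F \<subseteq> X closure_of (X interior_of F)" "X interior_of G \<subseteq> X closure_of (X interior_of G)"
    by (simp_all add: closure_of_subset interior_of_subset_topspace)
  have "W - G \<subseteq> X interior_of F"
    using W assms by (intro interior_of_maximal) (auto intro: openin_diff)
  then have "W \<subseteq> G" using sub W_def by blast
  then have "W \<subseteq> X interior_of G" by (simp add: W interior_of_maximal)
  then show ?thesis using sub W_def by blast
qed

text \<open>The source of (BC1) and (BC3): the closure of an open set that separates \<open>K\<close> from the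
  complement of \<open>U\<close>, inside a compact neighbourhood of \<open>K\<close>.\<close>
lemma compact_regular_closed_between:
  assumes "locally_compact_space X" "Hausdorff_space X" "compactin X K" "openin X U" "K \<subseteq> U"
  obtains B where "regular_closed X B" "compactin X B" "K \<subseteq> X interior_of B" "B \<subseteq> U"
proof -
  have reg: "regular_space X" using assms locally_compact_Hausdorff_imp_regular_space by blast
  obtain V L where VL: "openin X V" "compactin X L" "closedin X L" "K \<subseteq> V" "V \<subseteq> L"
    using assms locally_compact_space_compact_closed_compact by metis
  have "compactin X K" "closedin X (topspace X - (U \<inter> V))" "disjnt K (topspace X - (U \<inter> V))"
    using assms VL by (auto simp: disjnt_iff)
  then obtain W W' where W: "openin X W" "openin X W'" "K \<subseteq> W" "topspace X - (U \<inter> V) \<subseteq> W'" "disjnt W W'"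
    using regular_space_compact_closed_separation[OF reg] by metis
  let ?B = "X closure_of W"
  have "W \<subseteq> topspace X - W'" using W openin_subset by (fastforce simp: disjnt_iff)
  then have "?B \<subseteq> topspace X - W'" using W by (intro closure_of_minimal closedin_diff) auto
  then have BUV: "?B \<subseteq> U \<inter> V" using W closure_of_subset_topspace[of X W] by blast
  show thesis
  proof
    show "regular_closed X ?B" by (simp add: W regular_closed_closure_of_openin)
    show "compactin X ?B" using BUV VL
      by (meson closed_compactin closedin_closure_of le_inf_iff order_trans)
    show "K \<subseteq> X interior_of ?B"
      using W by (meson closure_of_subset interior_of_maximal openin_subset order_trans)
    show "?B \<subseteq> U" using BUV by blast
  qed
qed

lemma compact_regular_closed_neighbourhood:
  assumes "locally_compact_space X" "Hausdorff_space X" "openin X U" "x \<in> U"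
  obtains B where "regular_closed X B" "compactin X B" "x \<in> X interior_of B" "B \<subseteq> U"
proof -
  have "compactin X {x}" using assms openin_subset by (metis compactin_sing subsetD)
  then show thesis
    using compact_regular_closed_between[of X "{x}" U] assms that by auto
qed

section \<open>The local contact algebra of regular closed sets\<close>

text \<open>An isomorphism \<open>s\<close> from \<open>A\<close> onto the algebra of regular closed sets of \<open>X\<close>. Only the
  primitive relations are required to correspond; that the lattice operations correspond, and that
  \<open>A\<close> is a complete local contact algebra at all, follows.\<close>
locale regular_closed_representation =
  fixes X :: "'p topology" and A :: "'e local_contact_structure" and s :: "'e \<Rightarrow> 'p set"
  assumes locally_compact: "locally_compact_space X"
    and Hausdorff: "Hausdorff_space X"
    and bij: "bij_betw s (carrier A) {F. regular_closed X F}"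
    and eq_eq: "eq A = (=)"
    and le_iff: "\<lbrakk>a \<in> carrier A; b \<in> carrier A\<rbrakk> \<Longrightarrow> a \<sqsubseteq>\<^bsub>A\<^esub> b \<longleftrightarrow> s a \<subseteq> s b"
    and contact_iff: "\<lbrakk>a \<in> carrier A; b \<in> carrier A\<rbrakk> \<Longrightarrow> contact A a b \<longleftrightarrow> s a \<inter> s b \<noteq> {}"
    and bounded_eq: "bounded_elems A = {a \<in> carrier A. compactin X (s a)}"
begin

definition elem :: "'p set \<Rightarrow> 'e" where "elem = inv_into (carrier A) s"

lemma elem_closed [simp]: "regular_closed X F \<Longrightarrow> elem F \<in> carrier A"
  unfolding elem_def using bij by (metis bij_betw_imp_surj_on inv_into_into mem_Collect_eq)

lemma s_elem [simp]: "regular_closed X F \<Longrightarrow> s (elem F) = F"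
  unfolding elem_def using bij by (simp add: bij_betw_inv_into_right)

lemma elem_s [simp]: "a \<in> carrier A \<Longrightarrow> elem (s a) = a"
  unfolding elem_def using bij by (simp add: bij_betw_inv_into_left)

lemma regular_closed_s [simp]: "a \<in> carrier A \<Longrightarrow> regular_closed X (s a)"
  using bij bij_betwE by blast

lemma s_eq_iff: "\<lbrakk>a \<in> carrier A; b \<in> carrier A\<rbrakk> \<Longrightarrow> s a = s b \<longleftrightarrow> a = b"
  by (metis elem_s)

lemma closedin_s [simp]: "a \<in> carrier A \<Longrightarrow> closedin X (s a)"
  by (simp add: regular_closed_closedin)

lemma s_subset_topspace: "a \<in> carrier A \<Longrightarrow> s a \<subseteq> topspace X"
  by (simp add: regular_closed_subset)

lemma closure_of_interior_of_s: "a \<in> carrier A \<Longrightarrow> X closure_of (X interior_of (s a)) = s a"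
  by (metis regular_closed_def regular_closed_s)

lemma partial_order_A: "partial_order A"
proof
  show "(.=\<^bsub>A\<^esub>) = (=)" by (rule eq_eq)
qed (auto simp: eq_eq le_iff s_eq_iff)

sublocale partial_order A by (rule partial_order_A)

lemma regular_closed_sup_set:
  assumes "T \<subseteq> carrier A" shows "regular_closed X (X closure_of (\<Union>(s ` T)))"
proof -
  have "X closure_of (\<Union>(s ` T)) = X closure_of (\<Union>a\<in>T. X interior_of (s a))"
  proof
    have "s a \<subseteq> X closure_of (\<Union>a\<in>T. X interior_of (s a))" if "a \<in> T" for a
      using closure_of_interior_of_s[of a] that assms
      by (metis UN_upper closure_of_mono subsetD)
    then show "X closure_of (\<Union>(s ` T)) \<subseteq> X closure_of (\<Union>a\<in>T. X interior_of (s a))"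
      by (intro closure_of_minimal) auto
  qed (intro closure_of_mono UN_mono order_refl interior_of_subset)
  moreover have "openin X (\<Union>a\<in>T. X interior_of (s a))" by (rule openin_Union) auto
  ultimately show ?thesis by (simp only: regular_closed_closure_of_openin)
qed

lemma is_lub_elem:
  assumes "T \<subseteq> carrier A" shows "is_lub A (elem (X closure_of (\<Union>(s ` T)))) T"
proof (rule least_UpperI)
  have T: "\<And>a. a \<in> T \<Longrightarrow> a \<in> carrier A" using assms by blast
  note r = regular_closed_sup_set[OF assms]
  show "elem (X closure_of (\<Union>(s ` T))) \<in> carrier A" using r by simp
  have "\<Union>(s ` T) \<subseteq> topspace X" using T s_subset_topspace by blast
  then have "\<Union>(s ` T) \<subseteq> X closure_of (\<Union>(s ` T))" by (rule closure_of_subset)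
  then show "a \<sqsubseteq>\<^bsub>A\<^esub> elem (X closure_of (\<Union>(s ` T)))" if "a \<in> T" for a
    using that T r by (auto simp: le_iff)
  show "elem (X closure_of (\<Union>(s ` T))) \<sqsubseteq>\<^bsub>A\<^esub> b" if "b \<in> Upper A T" for b
  proof -
    have b: "b \<in> carrier A" using that by (simp add: Upper_def)
    have "s a \<subseteq> s b" if "a \<in> T" for a using that \<open>b \<in> Upper A T\<close> T b le_iff[of a b]
      by (auto simp: Upper_def)
    then show ?thesis using b r by (simp add: le_iff closure_of_minimal UN_least)
  qed
qed (fact assms)

lemma is_glb_elem:
  assumes "T \<subseteq> carrier A"
  shows "is_glb A (elem (X closure_of (X interior_of (topspace X \<inter> \<Inter>(s ` T))))) T"
    (is "is_glb A (elem ?I) T")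
proof (rule greatest_LowerI)
  have T: "\<And>a. a \<in> T \<Longrightarrow> a \<in> carrier A" using assms by blast
  have r: "regular_closed X ?I" by (simp add: regular_closed_closure_of_openin)
  show "elem ?I \<in> carrier A" using r by simp
  show "elem ?I \<sqsubseteq>\<^bsub>A\<^esub> a" if "a \<in> T" for a
  proof -
    have "X interior_of (topspace X \<inter> \<Inter>(s ` T)) \<subseteq> s a"
      using interior_of_subset that by fastforce
    then show ?thesis using that T r by (simp add: le_iff closure_of_minimal)
  qed
  show "b \<sqsubseteq>\<^bsub>A\<^esub> elem ?I" if "b \<in> Lower A T" for b
  proof -
    have b: "b \<in> carrier A" using that by (simp add: Lower_def)
    have "s b \<subseteq> s a" if "a \<in> T" for a using that \<open>b \<in> Lower A T\<close> T b le_iff[of b a]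
      by (auto simp: Lower_def)
    then have "s b \<subseteq> topspace X \<inter> \<Inter>(s ` T)" using s_subset_topspace[OF b] by blast
    then have "X closure_of X interior_of s b \<subseteq> ?I" by (intro closure_of_mono interior_of_mono)
    then show ?thesis using b r by (simp add: le_iff closure_of_interior_of_s)
  qed
qed (fact assms)

sublocale complete_lattice A
  by (rule complete_latticeI; rule exI; erule is_lub_elem is_glb_elem)

lemma s_Sup:
  assumes "T \<subseteq> carrier A" shows "s (\<Squnion>\<^bsub>A\<^esub>T) = X closure_of (\<Union>(s ` T))"
  using weak_least_unique[OF sup_lub[OF assms] is_lub_elem[OF assms]] regular_closed_sup_set[OF assms]
  by (simp add: eq_eq)

lemma s_Inf:
  assumes "T \<subseteq> carrier A"
  shows "s (\<Sqinter>\<^bsub>A\<^esub>T) = X closure_of (X interior_of (topspace X \<inter> \<Inter>(s ` T)))"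
  using weak_greatest_unique[OF inf_glb[OF assms] is_glb_elem[OF assms]]
  by (simp add: eq_eq regular_closed_closure_of_openin)

lemma s_join: "\<lbrakk>a \<in> carrier A; b \<in> carrier A\<rbrakk> \<Longrightarrow> s (a \<squnion>\<^bsub>A\<^esub> b) = s a \<union> s b"
  by (simp add: join_def s_Sup closure_of_Un closure_of_closedin)

lemma s_meet: "\<lbrakk>a \<in> carrier A; b \<in> carrier A\<rbrakk> \<Longrightarrow> s (a \<sqinter>\<^bsub>A\<^esub> b) = X closure_of (X interior_of (s a \<inter> s b))"
  using interior_of_restrict[of X "s a \<inter> s b"] by (simp add: meet_def s_Inf)

lemma regular_closed_empty [simp]: "regular_closed X {}"
  and regular_closed_topspace [simp]: "regular_closed X (topspace X)"
  by (simp_all add: regular_closed_def)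

lemma s_bottom: "s \<bottom>\<^bsub>A\<^esub> = {}"
  using bottom_lower[of "elem {}"] bottom_closed by (simp add: le_iff)

lemma s_top: "s \<top>\<^bsub>A\<^esub> = topspace X"
  using top_higher[of "elem (topspace X)"] top_closed s_subset_topspace[of "\<top>\<^bsub>A\<^esub>"]
    by (simp add: le_iff subset_antisym)

lemma s_eq_empty_iff: "a \<in> carrier A \<Longrightarrow> s a = {} \<longleftrightarrow> a = \<bottom>\<^bsub>A\<^esub>"
  by (metis s_bottom s_eq_iff bottom_closed)

lemma interior_of_s_eq_empty_iff: "a \<in> carrier A \<Longrightarrow> X interior_of (s a) = {} \<longleftrightarrow> a = \<bottom>\<^bsub>A\<^esub>"
  by (metis closure_of_empty closure_of_interior_of_s interior_of_empty s_eq_empty_iff)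

text \<open>Distributivity reduces to lemma \<open>interior_of_Un_subset_closure_of_interiors\<close>. The complement
  of \<open>F\<close> is the closure of \<open>X - F\<close>, whose interior is disjoint from that of \<open>F\<close>.\<close>
lemma boolean_lattice_A: "boolean_lattice A"
proof unfold_locales
  fix x y z assume xyz: "x \<in> carrier A" "y \<in> carrier A" "z \<in> carrier A"
  have "s (x \<sqinter>\<^bsub>A\<^esub> (y \<squnion>\<^bsub>A\<^esub> z)) = s (x \<sqinter>\<^bsub>A\<^esub> y \<squnion>\<^bsub>A\<^esub> x \<sqinter>\<^bsub>A\<^esub> z)"
    using xyz
  proof (simp add: s_join s_meet, intro subset_antisym closure_of_minimal)
    show "X interior_of (s x \<inter> (s y \<union> s z)) \<subseteq> X closure_of (X interior_of (s x \<inter> s y)) \<union> X closure_of (X interior_of (s x \<inter> s z))"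
      using interior_of_Un_subset_closure_of_interiors[of X "s x \<inter> s y" "s x \<inter> s z"] xyz
      by (simp add: Int_Un_distrib closedin_Int)
    show "X closure_of X interior_of (s x \<inter> s y) \<union> X closure_of X interior_of (s x \<inter> s z)
           \<subseteq> X closure_of X interior_of (s x \<inter> (s y \<union> s z))"
      by (intro Un_least closure_of_mono interior_of_mono) auto
  qed (auto simp: closedin_Un)
  then show "x \<sqinter>\<^bsub>A\<^esub> (y \<squnion>\<^bsub>A\<^esub> z) = x \<sqinter>\<^bsub>A\<^esub> y \<squnion>\<^bsub>A\<^esub> x \<sqinter>\<^bsub>A\<^esub> z"
    using xyz by (simp add: s_eq_iff)
next
  fix x assume x: "x \<in> carrier A"
  let ?F = "X closure_of (topspace X - s x)"
  have r: "regular_closed X ?F" using x by (simp add: regular_closed_closure_of_openin openin_diff)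
  have 1: "s (x \<squnion>\<^bsub>A\<^esub> elem ?F) = topspace X"
    using x r s_subset_topspace[OF x] closure_of_subset[of "topspace X - s x" X]
      closure_of_subset_topspace[of X "topspace X - s x"] by (auto simp: s_join)
  have "X interior_of (s x) \<inter> (topspace X - s x) = {}" using interior_of_subset by fastforce
  then have 2: "s (x \<sqinter>\<^bsub>A\<^esub> elem ?F) = {}"
    using x r
      by (simp add: s_meet interior_of_Int closure_of_complement interior_of_complement closure_of_interior_of_s)
  show "\<exists>y\<in>carrier A. x \<squnion>\<^bsub>A\<^esub> y = \<top>\<^bsub>A\<^esub> \<and> x \<sqinter>\<^bsub>A\<^esub> y = \<bottom>\<^bsub>A\<^esub>"
    using 1 2 x r
      by (intro bexI[of _ "elem ?F"]) (metis elem_closed join_closed s_eq_iff s_top top_closed meet_closed s_eq_empty_iff, simp)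
qed

sublocale boolean_lattice A by (rule boolean_lattice_A)

text \<open>The join and meet equations for the complement force it to contain the closure of \<open>X - s a\<close>
  and to have an interior disjoint from \<open>s a\<close>.\<close>
lemma s_bcompl:
  assumes a: "a \<in> carrier A" shows "s (bcompl A a) = X closure_of (topspace X - s a)"
proof
  let ?y = "bcompl A a"
  have y: "?y \<in> carrier A" using a by simp
  have "s a \<union> s ?y = topspace X" using a y by (metis s_join s_top join_bcompl)
  then show "X closure_of (topspace X - s a) \<subseteq> s ?y" using y by (intro closure_of_minimal) auto
  have "X closure_of (X interior_of (s a) \<inter> X interior_of (s ?y)) = {}"
    using y a by (metis s_meet s_bottom interior_of_Int meet_bcompl)
  then have "X interior_of (s a) \<inter> X interior_of (s ?y) = {}"
    by (metis closure_of_eq_empty_gen inf.coboundedI1 interior_of_subset_topspace Int_absorb1 disjnt_def)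
  then have "X interior_of (s ?y) \<inter> s a = {}"
    using a openin_Int_closure_of_eq_empty[of X "X interior_of (s ?y)" "X interior_of (s a)"]
    by (auto simp: closure_of_interior_of_s)
  then have "X interior_of (s ?y) \<subseteq> X closure_of (topspace X - s a)"
    using closure_of_subset[of "topspace X - s a" X] interior_of_subset_topspace[of X "s ?y"] by blast
  then show "s ?y \<subseteq> X closure_of (topspace X - s a)"
    using y closure_of_minimal[of "X interior_of (s ?y)"]
      by (metis closedin_closure_of closure_of_interior_of_s)
qed

text \<open>Being well inside is containment in the interior, which turns (BC1) and (BC3) into facts
  about compact neighbourhoods.\<close>
lemma well_inside_iff:
  "\<lbrakk>a \<in> carrier A; b \<in> carrier A\<rbrakk> \<Longrightarrow> well_inside A a b \<longleftrightarrow> s a \<subseteq> X interior_of (s b)"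
  using s_subset_topspace[of a]
    by (auto simp: well_inside_def contact_iff bcompl_closed s_bcompl closure_of_complement)

theorem complete_local_contact_algebra_A: "complete_local_contact_algebra A"
proof -
  have "local_contact_algebra A"
  proof
    show "boolean_ideal A (bounded_elems A)"
      unfolding boolean_ideal_def bounded_eq
      by (auto simp: s_bottom s_join le_iff compactin_Un intro: closed_compactin)
  next
    fix a c assume a: "a \<in> bounded_elems A" and c: "c \<in> carrier A" and "well_inside A a c"
    then obtain B where B: "regular_closed X B" "compactin X B" "s a \<subseteq> X interior_of B" "B \<subseteq> X interior_of (s c)"
      using compact_regular_closed_between[OF locally_compact Hausdorff, of "s a" "X interior_of (s c)"]
      by (auto simp: bounded_eq well_inside_iff)
    then show "\<exists>b\<in>bounded_elems A. well_inside A a b \<and> well_inside A b c"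
      using a c by (intro bexI[of _ "elem B"]) (auto simp: bounded_eq well_inside_iff)
  next
    fix a b assume a: "a \<in> carrier A" and b: "b \<in> carrier A" and "contact A a b"
    then obtain x where x: "x \<in> s a" "x \<in> s b" by (auto simp: contact_iff)
    then obtain B where B: "regular_closed X B" "compactin X B" "x \<in> X interior_of B"
      using compact_regular_closed_neighbourhood[OF locally_compact Hausdorff, of "topspace X" x]
        s_subset_topspace[OF a] by blast
    have "x \<in> X closure_of (X interior_of B \<inter> X interior_of (s b))"
      using B x b openin_Int_closure_of_subset[of X "X interior_of B" "X interior_of (s b)"]
      by (auto simp: closure_of_interior_of_s)
    then show "\<exists>c\<in>bounded_elems A. contact A a (c \<sqinter>\<^bsub>A\<^esub> b)"
      using a b B x
        by (intro bexI[of _ "elem B"]) (auto simp: bounded_eq contact_iff s_meet interior_of_Int)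
  next
    fix a assume a: "a \<in> carrier A" "a \<noteq> \<bottom>\<^bsub>A\<^esub>"
    then obtain x where "x \<in> X interior_of (s a)" by (auto simp: interior_of_s_eq_empty_iff[symmetric])
    then obtain B where B: "regular_closed X B" "compactin X B" "x \<in> X interior_of B" "B \<subseteq> X interior_of (s a)"
      using compact_regular_closed_neighbourhood[OF locally_compact Hausdorff, of "X interior_of (s a)" x] by auto
    then have "elem B \<noteq> \<bottom>\<^bsub>A\<^esub>" using interior_of_subset s_bottom s_elem by fastforce
    then show "\<exists>b\<in>bounded_elems A - {\<bottom>\<^bsub>A\<^esub>}. well_inside A b a"
      using a B by (intro bexI[of _ "elem B"]) (auto simp: bounded_eq well_inside_iff)
  qed (auto simp: contact_iff s_eq_empty_iff s_bottom s_join)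
  then show ?thesis by (simp add: complete_local_contact_algebra_def complete_lattice_axioms)
qed

end

section \<open>Open perfect maps induce morphisms\<close>

text \<open>Continuity gives one inclusion, openness of the map the other.\<close>
lemma closure_of_open_map_preimage:
  assumes f: "continuous_map X Y f" "open_map X Y f" and S: "S \<subseteq> topspace Y"
  shows "X closure_of {x \<in> topspace X. f x \<in> S} = {x \<in> topspace X. f x \<in> Y closure_of S}"
proof
  show "X closure_of {x \<in> topspace X. f x \<in> S} \<subseteq> {x \<in> topspace X. f x \<in> Y closure_of S}"
    using closure_of_subset[OF S]
    by (intro closure_of_minimal closedin_continuous_map_preimage[OF f(1)]) auto
  show "{x \<in> topspace X. f x \<in> Y closure_of S} \<subseteq> X closure_of {x \<in> topspace X. f x \<in> S}"
  proof (clarsimp simp: in_closure_of)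
    fix x U assume x: "\<forall>V. f x \<in> V \<and> openin Y V \<longrightarrow> (\<exists>y. y \<in> S \<and> y \<in> V)" and U: "x \<in> U" "openin X U"
    then have "openin Y (f ` U)" "f x \<in> f ` U" using f(2) by (auto simp: open_map_def)
    then obtain y where "y \<in> S" "y \<in> f ` U" using x by blast
    then show "\<exists>x'. x' \<in> topspace X \<and> f x' \<in> S \<and> x' \<in> U" using U openin_subset by blast
  qed
qed

lemma interior_of_open_map_preimage:
  assumes f: "continuous_map X Y f" "open_map X Y f"
  shows "X interior_of {x \<in> topspace X. f x \<in> S} = {x \<in> topspace X. f x \<in> Y interior_of S}"
proof -
  have "topspace X - {x \<in> topspace X. f x \<in> S} = {x \<in> topspace X. f x \<in> topspace Y - S}"
    using f(1) by (auto simp: continuous_map_def)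
  then show ?thesis
    using closure_of_open_map_preimage[OF f, of "topspace Y - S"] f(1)
    by (auto simp: interior_of_closure_of continuous_map_def)
qed

lemma regular_closed_open_map_preimage:
  assumes f: "continuous_map X Y f" "open_map X Y f" and F: "regular_closed Y F"
  shows "regular_closed X {x \<in> topspace X. f x \<in> F}"
  using F unfolding regular_closed_def
  by (simp add: interior_of_open_map_preimage[OF f] closure_of_open_map_preimage[OF f] interior_of_subset_topspace)

text \<open>Closedness of the map keeps the image closed, openness keeps the image of the dense interior
  inside the interior of the image.\<close>
lemma regular_closed_image:
  assumes f: "continuous_map X Y f" "open_map X Y f" "closed_map X Y f" and F: "regular_closed X F"
  shows "regular_closed Y (f ` F)"
  unfolding regular_closed_def
proof
  have c: "closedin Y (f ` F)" using f(3) F regular_closed_closedin by (auto simp: closed_map_def)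
  then show "Y closure_of (Y interior_of (f ` F)) \<subseteq> f ` F"
    by (simp add: closure_of_minimal interior_of_subset)
  have "f ` (X interior_of F) \<subseteq> Y interior_of (f ` F)"
    using f(2) by (simp add: open_map_interior_of_image_subset)
  then have "Y closure_of (f ` (X interior_of F)) \<subseteq> Y closure_of (Y interior_of (f ` F))"
    by (rule closure_of_mono)
  moreover have "f ` (X closure_of (X interior_of F)) \<subseteq> Y closure_of (f ` (X interior_of F))"
    using f(1) continuous_map_image_closure_subset by blast
  ultimately show "f ` F \<subseteq> Y closure_of (Y interior_of (f ` F))"
    using F by (simp add: regular_closed_def)
qed

lemma left_adjoint_eqI:
  assumes "partial_order A" "c \<in> carrier A"
    and "\<And>a. a \<in> carrier A \<Longrightarrow> b \<sqsubseteq>\<^bsub>B\<^esub> \<phi> a \<longleftrightarrow> c \<sqsubseteq>\<^bsub>A\<^esub> a"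
  shows "left_adjoint A B \<phi> b = c"
proof -
  interpret partial_order A by fact
  show ?thesis unfolding left_adjoint_def
  proof (rule the_equality)
    fix d assume "d \<in> carrier A \<and> (\<forall>a\<in>carrier A. b \<sqsubseteq>\<^bsub>B\<^esub> \<phi> a \<longleftrightarrow> d \<sqsubseteq>\<^bsub>A\<^esub> a)"
    then show "d = c" using assms(2,3) by (meson le_antisym le_refl)
  qed (use assms in auto)
qed

locale representation_pair =
  X: regular_closed_representation X A s + Y: regular_closed_representation Y B t
  for X :: "'p topology" and A :: "'e local_contact_structure" and s
    and Y :: "'q topology" and B :: "'d local_contact_structure" and t
begin

definition dual_map :: "('p \<Rightarrow> 'q) \<Rightarrow> 'd \<Rightarrow> 'e" where
  "dual_map f = restrict (\<lambda>b. X.elem {x \<in> topspace X. f x \<in> t b}) (carrier B)"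

context
  fixes f assumes f: "open_perfect_map X Y f"
begin

lemma f_props: "continuous_map X Y f" "open_map X Y f" "proper_map X Y f" "closed_map X Y f"
  using f by (auto simp: open_perfect_map_def proper_imp_closed_map)

lemma regular_closed_preimage: "b \<in> carrier B \<Longrightarrow> regular_closed X {x \<in> topspace X. f x \<in> t b}"
  using regular_closed_open_map_preimage f_props Y.regular_closed_s by metis

lemma s_dual_map: "b \<in> carrier B \<Longrightarrow> s (dual_map f b) = {x \<in> topspace X. f x \<in> t b}"
  by (simp add: dual_map_def regular_closed_preimage)

lemma dual_map_closed: "b \<in> carrier B \<Longrightarrow> dual_map f b \<in> carrier A"
  by (simp add: dual_map_def regular_closed_preimage)

text \<open>\<open>F \<subseteq> f\<^sup>-\<^sup>1(G)\<close> iff \<open>f(F) \<subseteq> G\<close>, and \<open>f(F)\<close> is itself regular closed.\<close>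
lemma left_adjoint_dual_map:
  assumes a: "a \<in> carrier A"
  shows "left_adjoint B A (dual_map f) a = Y.elem (f ` s a)" and "regular_closed Y (f ` s a)"
proof -
  show r: "regular_closed Y (f ` s a)" using regular_closed_image f_props a X.regular_closed_s by metis
  show "left_adjoint B A (dual_map f) a = Y.elem (f ` s a)"
  proof (rule left_adjoint_eqI[OF Y.partial_order_A])
    fix b assume "b \<in> carrier B"
    then show "a \<sqsubseteq>\<^bsub>A\<^esub> dual_map f b \<longleftrightarrow> Y.elem (f ` s a) \<sqsubseteq>\<^bsub>B\<^esub> b"
      using a r X.s_subset_topspace[OF a]
      by (auto simp: X.le_iff Y.le_iff dual_map_closed s_dual_map)
  qed (simp add: r)
qed

lemma complete_boolean_hom_dual_map: "complete_boolean_hom B A (dual_map f)"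
  unfolding complete_boolean_hom_def
proof (intro conjI ballI)
  show "dual_map f \<in> carrier B \<rightarrow> carrier A" by (simp add: dual_map_closed)
next
  fix b assume b: "b \<in> carrier B"
  have "s (dual_map f (bcompl B b)) = {x \<in> topspace X. f x \<in> Y closure_of (topspace Y - t b)}"
    using b by (simp add: s_dual_map Y.bcompl_closed Y.s_bcompl)
  also have "\<dots> = X closure_of {x \<in> topspace X. f x \<in> topspace Y - t b}"
    by (rule closure_of_open_map_preimage[symmetric]) (simp_all add: f_props)
  also have "{x \<in> topspace X. f x \<in> topspace Y - t b} = topspace X - {x \<in> topspace X. f x \<in> t b}"
    using f_props(1) by (auto simp: continuous_map_def)
  also have "X closure_of \<dots> = s (bcompl A (dual_map f b))"
    using b by (simp add: X.s_bcompl s_dual_map dual_map_closed)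
  finally show "dual_map f (bcompl B b) = bcompl A (dual_map f b)"
    using b by (simp add: X.s_eq_iff X.bcompl_closed Y.bcompl_closed dual_map_closed)
next
  have "dual_map f (\<Squnion>\<^bsub>B\<^esub> T) = \<Squnion>\<^bsub>A\<^esub> (dual_map f ` T)" if T: "T \<subseteq> carrier B" for T
  proof -
    have im: "dual_map f ` T \<subseteq> carrier A" using T dual_map_closed by blast
    have "\<Union>(t ` T) \<subseteq> topspace Y" using T Y.s_subset_topspace by blast
    then have "s (dual_map f (\<Squnion>\<^bsub>B\<^esub> T)) = X closure_of {x \<in> topspace X. f x \<in> \<Union>(t ` T)}"
      using T closure_of_open_map_preimage[OF f_props(1,2), of "\<Union>(t ` T)"]
        by (simp add: s_dual_map Y.s_Sup)
    also have "{x \<in> topspace X. f x \<in> \<Union>(t ` T)} = \<Union>(s ` dual_map f ` T)"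
      using T by (auto simp: s_dual_map subset_iff)
    finally have "s (dual_map f (\<Squnion>\<^bsub>B\<^esub> T)) = s (\<Squnion>\<^bsub>A\<^esub> (dual_map f ` T))"
      using im by (simp add: X.s_Sup)
    then show ?thesis using T im by (subst (asm) X.s_eq_iff) (simp_all add: dual_map_closed)
  qed
  then show "sup_pres B A (dual_map f)"
    by (simp add: sup_pres_def X.complete_lattice_axioms Y.complete_lattice_axioms)
next
  have "dual_map f (\<Sqinter>\<^bsub>B\<^esub> T) = \<Sqinter>\<^bsub>A\<^esub> (dual_map f ` T)" if T: "T \<subseteq> carrier B" for T
  proof -
    have im: "dual_map f ` T \<subseteq> carrier A" using T dual_map_closed by blast
    have "s (dual_map f (\<Sqinter>\<^bsub>B\<^esub> T)) =
        X closure_of (X interior_of {x \<in> topspace X. f x \<in> topspace Y \<inter> \<Inter>(t ` T)})"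
      unfolding interior_of_open_map_preimage[OF f_props(1,2)]
      using T closure_of_open_map_preimage[OF f_props(1,2) interior_of_subset_topspace]
      by (simp add: s_dual_map Y.s_Inf)
    also have "{x \<in> topspace X. f x \<in> topspace Y \<inter> \<Inter>(t ` T)} = topspace X \<inter> \<Inter>(s ` dual_map f ` T)"
      using T f_props(1) by (auto simp: s_dual_map subset_iff continuous_map_def)
    finally have "s (dual_map f (\<Sqinter>\<^bsub>B\<^esub> T)) = s (\<Sqinter>\<^bsub>A\<^esub> (dual_map f ` T))"
      using im by (simp add: X.s_Inf)
    then show ?thesis using T im by (subst (asm) X.s_eq_iff) (simp_all add: dual_map_closed)
  qed
  then show "inf_pres B A (dual_map f)"
    by (simp add: inf_pres_def X.complete_lattice_axioms Y.complete_lattice_axioms)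
qed

text \<open>With the left adjoint known to be the direct image, (L2) says that images of compact sets
  are compact, (L3) that preimages of compact sets are compact, and (LO) that \<open>f(F) \<inter> G \<noteq> {}\<close>
  implies \<open>F \<inter> f\<^sup>-\<^sup>1(G) \<noteq> {}\<close>.\<close>
theorem DOpPerLC_morphism_dual_map: "DOpPerLC_morphism B A (dual_map f)"
  unfolding DOpPerLC_morphism_def
proof (intro conjI ballI impI)
  fix a assume "a \<in> bounded_elems A"
  then show "left_adjoint B A (dual_map f) a \<in> bounded_elems B"
    using image_compactin f_props by (auto simp: left_adjoint_dual_map X.bounded_eq Y.bounded_eq)
next
  fix b assume "b \<in> bounded_elems B"
  then show "dual_map f b \<in> bounded_elems A"
    using compactin_proper_map_preimage f_props(3)
    by (auto simp: X.bounded_eq Y.bounded_eq dual_map_closed s_dual_map)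
next
  fix b a assume "b \<in> carrier B" "a \<in> bounded_elems A" "contact B (left_adjoint B A (dual_map f) a) b"
  then show "contact A a (dual_map f b)"
    using X.s_subset_topspace[of a]
    by (auto simp: left_adjoint_dual_map X.bounded_eq X.contact_iff Y.contact_iff dual_map_closed s_dual_map)
qed (auto simp: complete_boolean_hom_dual_map X.contact_iff Y.contact_iff dual_map_closed s_dual_map)

end

lemma dual_map_inject:
  assumes f: "open_perfect_map X Y f" and g: "open_perfect_map X Y g"
    and eq: "dual_map f = dual_map g" and x: "x \<in> topspace X"
  shows "f x = g x"
proof (rule ccontr)
  assume ne: "f x \<noteq> g x"
  have "f x \<in> topspace Y" "g x \<in> topspace Y"
    using f g x by (auto simp: open_perfect_map_def continuous_map_def)
  then obtain U V where UV: "openin Y U" "openin Y V" "f x \<in> U" "g x \<in> V" "disjnt U V"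
    using ne Y.Hausdorff unfolding Hausdorff_space_def by metis
  then obtain F where F: "regular_closed Y F" "f x \<in> Y interior_of F" "F \<subseteq> U"
    using compact_regular_closed_neighbourhood Y.locally_compact Y.Hausdorff by metis
  then have "f x \<in> F" using interior_of_subset by fastforce
  then have "x \<in> s (dual_map f (Y.elem F))" using x F by (simp add: s_dual_map f)
  then have "g x \<in> F" using F by (simp add: eq s_dual_map g)
  then show False using UV F by (auto simp: disjnt_iff)
qed

end

section \<open>Every morphism is induced by an open perfect map\<close>

lemma inf_pres_meet:
  assumes "inf_pres A B \<phi>" "a \<in> carrier A" "a' \<in> carrier A"
  shows "\<phi> (a \<sqinter>\<^bsub>A\<^esub> a') = \<phi> a \<sqinter>\<^bsub>B\<^esub> \<phi> a'"
  using assms(1)[unfolded inf_pres_def, THEN conjunct2, THEN conjunct2, THEN spec, of "{a, a'}"] assms(2,3)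
  by (simp add: meet_def)

lemma inf_pres_monotone:
  assumes "inf_pres A B \<phi>" "a \<in> carrier A" "a' \<in> carrier A" "\<phi> \<in> carrier A \<rightarrow> carrier B" "a \<sqsubseteq>\<^bsub>A\<^esub> a'"
  shows "\<phi> a \<sqsubseteq>\<^bsub>B\<^esub> \<phi> a'"
proof -
  interpret A: complete_lattice A using assms(1) by (simp add: inf_pres_def)
  interpret B: complete_lattice B using assms(1) by (simp add: inf_pres_def)
  have "a = a \<sqinter>\<^bsub>A\<^esub> a'" using A.le_iff_join[of a a'] assms(2,3,5) by simp
  then have "\<phi> a = \<phi> a \<sqinter>\<^bsub>B\<^esub> \<phi> a'" using inf_pres_meet[OF assms(1-3)] by simp
  then show ?thesis using B.le_iff_join[of "\<phi> a" "\<phi> a'"] assms(2-4) by auto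
qed

text \<open>A map that preserves all meets has the left adjoint \<open>b \<mapsto> \<Sqinter>{a. b \<sqsubseteq> \<phi> a}\<close>.\<close>
lemma left_adjoint_adjunction:
  assumes \<phi>: "inf_pres A B \<phi>" "\<phi> \<in> carrier A \<rightarrow> carrier B" and b: "b \<in> carrier B"
  shows left_adjoint_closed: "left_adjoint A B \<phi> b \<in> carrier A"
    and left_adjoint_iff: "a \<in> carrier A \<Longrightarrow> b \<sqsubseteq>\<^bsub>B\<^esub> \<phi> a \<longleftrightarrow> left_adjoint A B \<phi> b \<sqsubseteq>\<^bsub>A\<^esub> a"
proof -
  interpret A: complete_lattice A using \<phi> by (simp add: inf_pres_def)
  interpret B: complete_lattice B using \<phi> by (simp add: inf_pres_def)
  let ?T = "{a \<in> carrier A. b \<sqsubseteq>\<^bsub>B\<^esub> \<phi> a}"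
  define c where "c = \<Sqinter>\<^bsub>A\<^esub> ?T"
  have c: "c \<in> carrier A" by (simp add: c_def)
  have "\<phi> c = \<Sqinter>\<^bsub>B\<^esub> (\<phi> ` ?T)" using \<phi> by (simp add: inf_pres_def c_def)
  then have bc: "b \<sqsubseteq>\<^bsub>B\<^esub> \<phi> c" using \<phi>(2) b by (auto intro!: B.inf_greatest)
  have *: "b \<sqsubseteq>\<^bsub>B\<^esub> \<phi> a \<longleftrightarrow> c \<sqsubseteq>\<^bsub>A\<^esub> a" if a: "a \<in> carrier A" for a
  proof
    show "c \<sqsubseteq>\<^bsub>A\<^esub> a" if "b \<sqsubseteq>\<^bsub>B\<^esub> \<phi> a" using a that by (auto simp: c_def intro!: A.inf_lower)
    show "b \<sqsubseteq>\<^bsub>B\<^esub> \<phi> a" if "c \<sqsubseteq>\<^bsub>A\<^esub> a"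
      using inf_pres_monotone[OF \<phi>(1) c a \<phi>(2) that] bc b c a \<phi>(2) by (meson B.le_trans Pi_mem)
  qed
  have "left_adjoint A B \<phi> b = c"
    by (rule left_adjoint_eqI) (use c * A.partial_order_axioms in auto)
  then show "left_adjoint A B \<phi> b \<in> carrier A"
    and "a \<in> carrier A \<Longrightarrow> b \<sqsubseteq>\<^bsub>B\<^esub> \<phi> a \<longleftrightarrow> left_adjoint A B \<phi> b \<sqsubseteq>\<^bsub>A\<^esub> a"
    using c * by auto
qed

context regular_closed_representation
begin

lemma interior_of_s_bcompl: "a \<in> carrier A \<Longrightarrow> X interior_of (s (bcompl A a)) = topspace X - s a"
  by (simp add: s_bcompl interior_of_complement closure_of_complement closure_of_interior_of_s)

lemma s_bcompl_interior: "a \<in> carrier A \<Longrightarrow> s (bcompl A a) = topspace X - X interior_of (s a)"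
  by (simp add: s_bcompl closure_of_complement)

lemma neighbourhood_elem:
  assumes "openin X U" "x \<in> U"
  obtains b where "b \<in> bounded_elems A" "x \<in> X interior_of (s b)" "s b \<subseteq> U"
  using compact_regular_closed_neighbourhood[OF locally_compact Hausdorff assms]
  by (metis (no_types, lifting) bounded_eq elem_closed mem_Collect_eq s_elem)

end

context representation_pair
begin

context
  fixes \<phi> assumes \<phi>: "DOpPerLC_morphism B A \<phi>"
begin

lemma \<phi>_closed [simp]: "b \<in> carrier B \<Longrightarrow> \<phi> b \<in> carrier A"
  and \<phi>_funcset: "\<phi> \<in> carrier B \<rightarrow> carrier A"
  and \<phi>_inf: "inf_pres B A \<phi>"
  and \<phi>_bcompl: "b \<in> carrier B \<Longrightarrow> \<phi> (bcompl B b) = bcompl A (\<phi> b)"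
  using \<phi> by (auto simp: DOpPerLC_morphism_def complete_boolean_hom_def)

lemma \<phi>_L1:
  assumes "b \<in> carrier B" "c \<in> carrier B" "s (\<phi> b) \<inter> s (\<phi> c) \<noteq> {}" shows "t b \<inter> t c \<noteq> {}"
proof -
  have "contact A (\<phi> b) (\<phi> c)" using assms by (simp add: X.contact_iff)
  then have "contact B b c" using assms \<phi> by (simp add: DOpPerLC_morphism_def)
  then show ?thesis using assms by (simp add: Y.contact_iff)
qed

abbreviation "\<phi>\<^sub>\<Lambda> \<equiv> left_adjoint B A \<phi>"

lemma \<phi>\<^sub>\<Lambda>_closed [simp]: "a \<in> carrier A \<Longrightarrow> \<phi>\<^sub>\<Lambda> a \<in> carrier B"
  using \<phi>_inf \<phi>_funcset left_adjoint_closed by metis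

lemma \<phi>\<^sub>\<Lambda>_iff: "\<lbrakk>a \<in> carrier A; b \<in> carrier B\<rbrakk> \<Longrightarrow> s a \<subseteq> s (\<phi> b) \<longleftrightarrow> t (\<phi>\<^sub>\<Lambda> a) \<subseteq> t b"
  using left_adjoint_iff[OF \<phi>_inf \<phi>_funcset, of a b] by (simp add: X.le_iff Y.le_iff)

lemma s_subset_\<phi>\<phi>\<^sub>\<Lambda>: "a \<in> carrier A \<Longrightarrow> s a \<subseteq> s (\<phi> (\<phi>\<^sub>\<Lambda> a))"
  by (simp add: \<phi>\<^sub>\<Lambda>_iff)

lemma compactin_\<phi>\<^sub>\<Lambda>: "a \<in> bounded_elems A \<Longrightarrow> compactin Y (t (\<phi>\<^sub>\<Lambda> a))"
  using \<phi> by (auto simp: DOpPerLC_morphism_def Y.bounded_eq)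

lemma \<phi>_meet: "\<lbrakk>b \<in> carrier B; c \<in> carrier B\<rbrakk> \<Longrightarrow> \<phi> (b \<sqinter>\<^bsub>B\<^esub> c) = \<phi> b \<sqinter>\<^bsub>A\<^esub> \<phi> c"
  using inf_pres_meet[OF \<phi>_inf] .

text \<open>If \<open>\<phi>\<close> is to be \<open>G \<mapsto> f\<^sup>-\<^sup>1(G)\<close>, the elements of the trace of \<open>x\<close> are those that must be
  neighbourhoods of \<open>f(x)\<close>.\<close>
definition trace :: "'p \<Rightarrow> 'd set" where
  "trace x = {b \<in> carrier B. x \<in> X interior_of (s (\<phi> b))}"

text \<open>An arbitrary choice is harmless: every common point of the trace satisfies lemma
  \<open>point_map_iff\<close>, which determines it.\<close>
definition point_map :: "'p \<Rightarrow> 'q" where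
  "point_map x = (SOME y. y \<in> topspace Y \<and> (\<forall>b\<in>trace x. y \<in> t b))"

lemma \<phi>\<^sub>\<Lambda>_in_trace:
  assumes "a \<in> carrier A" "x \<in> X interior_of (s a)" shows "\<phi>\<^sub>\<Lambda> a \<in> trace x"
  using assms interior_of_mono[OF s_subset_\<phi>\<phi>\<^sub>\<Lambda>, of a X] by (auto simp: trace_def)

lemma trace_finite_bound:
  assumes "finite F" "F \<subseteq> trace x" "k \<in> trace x"
  shows "\<exists>b\<in>trace x. t b \<subseteq> t k \<and> (\<forall>c\<in>F. t b \<subseteq> t c)"
  using assms
proof (induction F)
  case (insert c F)
  then obtain b where b: "b \<in> trace x" "t b \<subseteq> t k" "\<forall>c\<in>F. t b \<subseteq> t c" by auto
  have bc: "b \<in> carrier B" "c \<in> carrier B" using b insert by (auto simp: trace_def)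
  let ?m = "b \<sqinter>\<^bsub>B\<^esub> c"
  have m: "t ?m \<subseteq> t b" "t ?m \<subseteq> t c"
    using bc Y.meet_left[of b c] Y.meet_right[of b c] by (auto simp: Y.le_iff)
  have "X interior_of (s (\<phi> b)) \<inter> X interior_of (s (\<phi> c)) \<subseteq> X interior_of (s (\<phi> ?m))"
    unfolding interior_of_Int[symmetric] using bc
    by (intro interior_of_maximal openin_interior_of)
      (simp add: \<phi>_meet X.s_meet closure_of_subset interior_of_subset_topspace)
  then have "?m \<in> trace x" using b insert bc by (auto simp: trace_def)
  then show ?case using b m by blast
qed auto

text \<open>The trace has the finite intersection property, because \<open>x \<in> \<phi>(b)\<close> forces \<open>b\<close> to be
  nonempty, and one of its members is compact by (L2).\<close>
lemma point_map_trace: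
  assumes x: "x \<in> topspace X"
  shows point_map_in: "point_map x \<in> topspace Y" and "b \<in> trace x \<Longrightarrow> point_map x \<in> t b"
proof -
  \<comment> \<open>A compact neighbourhood of the point provides a compact member of the trace.\<close>
  obtain a where a: "a \<in> bounded_elems A" "x \<in> X interior_of (s a)"
    using X.neighbourhood_elem[OF openin_topspace x] by blast
  have k: "\<phi>\<^sub>\<Lambda> a \<in> trace x" using a by (intro \<phi>\<^sub>\<Lambda>_in_trace) (auto simp: X.bounded_eq)
  have "t (\<phi>\<^sub>\<Lambda> a) \<inter> \<Inter>(t ` trace x) \<noteq> {}"
  proof -
    have "\<forall>C\<in>t ` trace x. closedin Y C" by (auto simp: trace_def)
    moreover have "t (\<phi>\<^sub>\<Lambda> a) \<inter> \<Inter>\<F> \<noteq> {}" if \<F>: "finite \<F>" "\<F> \<subseteq> t ` trace x" for \<F>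
    proof -
      obtain F where F: "F \<subseteq> trace x" "finite F" "\<F> = t ` F" using finite_subset_image[OF \<F>] by blast
      obtain b where b: "b \<in> trace x" "t b \<subseteq> t (\<phi>\<^sub>\<Lambda> a)" "\<forall>c\<in>F. t b \<subseteq> t c"
        using trace_finite_bound[OF F(2,1) k] by blast
      have "x \<in> s (\<phi> b)" "b \<in> carrier B" using b(1) interior_of_subset by (fastforce simp: trace_def)+
      then have "t b \<noteq> {}" using \<phi>_L1[of b b] by auto
      then show ?thesis using b F by blast
    qed
    ultimately show ?thesis
      using compactin_\<phi>\<^sub>\<Lambda>[OF a(1), unfolded compactin_fip, THEN conjunct2, THEN spec, of "t ` trace x"] by blast
  qed
  then have "\<exists>y. y \<in> topspace Y \<and> (\<forall>b\<in>trace x. y \<in> t b)"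
    using compactin_\<phi>\<^sub>\<Lambda>[OF a(1)] compactin_subset_topspace by blast
  from someI_ex[OF this] show "point_map x \<in> topspace Y" "b \<in> trace x \<Longrightarrow> point_map x \<in> t b"
    by (auto simp: point_map_def)
qed

text \<open>If \<open>x\<close> is outside \<open>\<phi>(b)\<close>, it is interior to \<open>\<phi>(b\<^sup>*)\<close>, so \<open>b\<^sup>*\<close> belongs to the trace and
  contains the image of \<open>x\<close>.\<close>
lemma point_map_interior:
  assumes "x \<in> topspace X" "b \<in> carrier B" "point_map x \<in> Y interior_of (t b)" shows "x \<in> s (\<phi> b)"
proof (rule ccontr)
  assume "x \<notin> s (\<phi> b)"
  then have "bcompl B b \<in> trace x"
    using assms by (simp add: trace_def Y.bcompl_closed \<phi>_bcompl X.interior_of_s_bcompl)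
  then show False using point_map_trace[OF assms(1)] assms by (force simp: Y.s_bcompl_interior)
qed

text \<open>From right to left: otherwise a neighbourhood of the image disjoint from \<open>b\<close> would, by (L1),
  have an image under \<open>\<phi>\<close> that is disjoint from \<open>\<phi>(b)\<close> but contains \<open>x\<close>. From left to right:
  otherwise \<open>x\<close> has a compact neighbourhood \<open>a\<close> disjoint from \<open>\<phi>(b)\<close>; by (LO), \<open>\<phi>\<^sub>\<Lambda>(a)\<close> is
  disjoint from \<open>b\<close>, but it belongs to the trace of \<open>x\<close>.\<close>
lemma point_map_iff:
  assumes x: "x \<in> topspace X" and b: "b \<in> carrier B"
  shows "point_map x \<in> t b \<longleftrightarrow> x \<in> s (\<phi> b)"
proof
  assume "x \<in> s (\<phi> b)"
  show "point_map x \<in> t b"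
  proof (rule ccontr)
    assume "point_map x \<notin> t b"
    then obtain h where h: "h \<in> bounded_elems B" "point_map x \<in> Y interior_of (t h)" "t h \<subseteq> topspace Y - t b"
      using Y.neighbourhood_elem[of "topspace Y - t b" "point_map x"] point_map_in[OF x] b
        by (auto simp: openin_diff)
    then have hc: "h \<in> carrier B" by (simp add: Y.bounded_eq)
    then have "x \<in> s (\<phi> h)" using h x point_map_interior by blast
    then show False using \<phi>_L1[of b h] \<open>x \<in> s (\<phi> b)\<close> h b hc by blast
  qed
next
  assume *: "point_map x \<in> t b"
  show "x \<in> s (\<phi> b)"
  proof (rule ccontr)
    assume "x \<notin> s (\<phi> b)"
    then obtain a where a: "a \<in> bounded_elems A" "x \<in> X interior_of (s a)" "s a \<subseteq> topspace X - s (\<phi> b)"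
      using X.neighbourhood_elem[of "topspace X - s (\<phi> b)" x] x b by (auto simp: openin_diff)
    then have ac: "a \<in> carrier A" by (simp add: X.bounded_eq)
    have "\<not> contact A a (\<phi> b)" using a ac b by (auto simp: X.contact_iff)
    then have "\<not> contact B (\<phi>\<^sub>\<Lambda> a) b" using \<phi> a b by (auto simp: DOpPerLC_morphism_def)
    then have "t (\<phi>\<^sub>\<Lambda> a) \<inter> t b = {}" using ac b by (simp add: Y.contact_iff)
    moreover have "point_map x \<in> t (\<phi>\<^sub>\<Lambda> a)" using \<phi>\<^sub>\<Lambda>_in_trace[OF ac a(2)] point_map_trace[OF x] by blast
    ultimately show False using * by blast
  qed
qed

lemma continuous_point_map: "continuous_map X Y point_map"
  unfolding continuous_map_def
proof (intro conjI allI impI)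
  show "point_map \<in> topspace X \<rightarrow> topspace Y" using point_map_in by blast
  fix U assume U: "openin Y U"
  show "openin X {x \<in> topspace X. point_map x \<in> U}"
  proof (subst openin_subopen, clarify)
    fix x assume x: "x \<in> topspace X" "point_map x \<in> U"
    then obtain b where b: "b \<in> bounded_elems B" "point_map x \<in> Y interior_of (t b)" "t b \<subseteq> U"
      using Y.neighbourhood_elem[OF U] by blast
    have bc: "b \<in> carrier B" "bcompl B b \<in> carrier B" using b
      by (auto simp: Y.bounded_eq Y.bcompl_closed)
    have "point_map z \<in> U" if "z \<in> topspace X - s (\<phi> (bcompl B b))" for z
      using that b bc interior_of_subset[of Y "t b"] point_map_in[of z] point_map_iff[of z "bcompl B b"]
      by (auto simp: Y.s_bcompl_interior)
    moreover have "x \<in> topspace X - s (\<phi> (bcompl B b))"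
      using x b bc point_map_iff[of x "bcompl B b"] by (auto simp: Y.s_bcompl_interior)
    moreover have "openin X (topspace X - s (\<phi> (bcompl B b)))" using bc by (simp add: openin_diff)
    ultimately show "\<exists>T. openin X T \<and> x \<in> T \<and> T \<subseteq> {x \<in> topspace X. point_map x \<in> U}"
      by (intro exI[of _ "topspace X - s (\<phi> (bcompl B b))"]) auto
  qed
qed

text \<open>A compact set lies in a bounded element, whose preimage is compact by (L3); since locally
  compact Hausdorff spaces are compactly generated, compactness of preimages suffices.\<close>
lemma proper_point_map: "proper_map X Y point_map"
proof (rule compact_imp_proper_map)
  show "k_space Y" by (simp add: Y.locally_compact locally_compact_imp_k_space)
  show "kc_space Y" by (simp add: Y.Hausdorff Hausdorff_imp_kc_space)
  show "point_map \<in> topspace X \<rightarrow> topspace Y" using point_map_in by blast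
  show "continuous_map X Y point_map \<or> kc_space X" using continuous_point_map by blast
  fix K assume K: "compactin Y K"
  obtain G where G: "regular_closed Y G" "compactin Y G" "K \<subseteq> Y interior_of G"
    using compact_regular_closed_between[OF Y.locally_compact Y.Hausdorff K openin_topspace
      compactin_subset_topspace[OF K]] by metis
  have "Y.elem G \<in> bounded_elems B" using G by (simp add: Y.bounded_eq)
  then have "compactin X (s (\<phi> (Y.elem G)))"
    using \<phi> by (auto simp: DOpPerLC_morphism_def X.bounded_eq)
  moreover have "{x \<in> topspace X. point_map x \<in> K} \<subseteq> s (\<phi> (Y.elem G))"
    using G interior_of_subset[of Y G] point_map_iff[of _ "Y.elem G"] by auto
  moreover have "closedin X {x \<in> topspace X. point_map x \<in> K}"
    using closedin_continuous_map_preimage[OF continuous_point_map] compactin_imp_closedin[OF Y.Hausdorff K] .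
  ultimately show "compactin X {x \<in> topspace X. point_map x \<in> K}"
    using closed_compactin by blast
qed

text \<open>The image of \<open>a\<close> is compact, hence closed, hence the intersection of the regular closed sets
  above it; and by adjunction \<open>\<phi>\<^sub>\<Lambda>(a)\<close> lies below each of these.\<close>
lemma \<phi>\<^sub>\<Lambda>_subset_image:
  assumes a: "a \<in> bounded_elems A" shows "t (\<phi>\<^sub>\<Lambda> a) \<subseteq> point_map ` s a"
proof
  have ac: "a \<in> carrier A" "compactin X (s a)" using a by (auto simp: X.bounded_eq)
  fix y assume y: "y \<in> t (\<phi>\<^sub>\<Lambda> a)"
  show "y \<in> point_map ` s a"
  proof (rule ccontr)
    assume ny: "y \<notin> point_map ` s a"
    have "closedin Y (point_map ` s a)"
      using image_compactin[OF ac(2) continuous_point_map] compactin_imp_closedin[OF Y.Hausdorff] by blast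
    then have "openin Y (topspace Y - point_map ` s a)" by (simp add: openin_diff)
    moreover have "y \<in> topspace Y - point_map ` s a"
      using y ny ac Y.s_subset_topspace[of "\<phi>\<^sub>\<Lambda> a"] by auto
    ultimately obtain d where d: "d \<in> bounded_elems B" "y \<in> Y interior_of (t d)" "t d \<subseteq> topspace Y - point_map ` s a"
      using Y.neighbourhood_elem by blast
    then have dc: "d \<in> carrier B" "bcompl B d \<in> carrier B" by (auto simp: Y.bounded_eq Y.bcompl_closed)
    have "s a \<subseteq> s (\<phi> (bcompl B d))"
    proof
      fix x assume x: "x \<in> s a"
      then have xX: "x \<in> topspace X" using X.s_subset_topspace ac by blast
      have "point_map x \<in> t (bcompl B d)"
        using d dc x point_map_in[OF xX] interior_of_subset[of Y "t d"]
          by (auto simp: Y.s_bcompl_interior)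
      then show "x \<in> s (\<phi> (bcompl B d))" using point_map_iff xX dc by blast
    qed
    then have "y \<in> t (bcompl B d)" using \<phi>\<^sub>\<Lambda>_iff[of a "bcompl B d"] ac dc y by blast
    then show False using d dc by (simp add: Y.s_bcompl_interior)
  qed
qed

text \<open>If \<open>x\<close> is interior to \<open>a \<subseteq> \<phi>(\<phi>\<^sub>\<Lambda>(a))\<close>, then \<open>x\<close> is not in \<open>\<phi>\<close> of the complement of \<open>\<phi>\<^sub>\<Lambda>(a)\<close>,
  so its image is interior to \<open>\<phi>\<^sub>\<Lambda>(a)\<close>.\<close>
lemma open_point_map: "open_map X Y point_map"
  unfolding open_map_def
proof (intro allI impI)
  fix U assume U: "openin X U"
  show "openin Y (point_map ` U)"
  proof (subst openin_subopen, clarify)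
    fix x assume x: "x \<in> U"
    then have xX: "x \<in> topspace X" using U openin_subset by blast
    obtain a where a: "a \<in> bounded_elems A" "x \<in> X interior_of (s a)" "s a \<subseteq> U"
      using X.neighbourhood_elem[OF U x] by blast
    then have ac: "a \<in> carrier A" by (simp add: X.bounded_eq)
    let ?l = "\<phi>\<^sub>\<Lambda> a"
    have "?l \<in> trace x" using \<phi>\<^sub>\<Lambda>_in_trace ac a by blast
    then have "x \<notin> s (\<phi> (bcompl B ?l))"
      using ac by (simp add: \<phi>_bcompl X.s_bcompl_interior trace_def)
    then have "point_map x \<notin> t (bcompl B ?l)" using point_map_iff xX ac by (simp add: Y.bcompl_closed)
    then have "point_map x \<in> Y interior_of (t ?l)"
      using ac point_map_in[OF xX] by (simp add: Y.s_bcompl_interior)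
    moreover have "Y interior_of (t ?l) \<subseteq> point_map ` U"
      using \<phi>\<^sub>\<Lambda>_subset_image[OF a(1)] a(3) interior_of_subset[of Y "t ?l"] by blast
    ultimately show "\<exists>T. openin Y T \<and> point_map x \<in> T \<and> T \<subseteq> point_map ` U"
      by (intro exI[of _ "Y interior_of (t ?l)"]) auto
  qed
qed

lemma open_perfect_point_map: "open_perfect_map X Y point_map"
  by (simp add: open_perfect_map_def continuous_point_map open_point_map proper_point_map)

end

end

section \<open>Contact ends\<close>

context local_contact_algebra
begin

abbreviation well_inside_syntax (infix "\<lless>" 50) where "a \<lless> b \<equiv> well_inside L a b"

lemma bounded_elemsD:
  shows bounded_closed: "a \<in> bounded_elems L \<Longrightarrow> a \<in> carrier L"
    and bounded_down: "\<lbrakk>a \<in> bounded_elems L; b \<in> carrier L; b \<sqsubseteq> a\<rbrakk> \<Longrightarrow> b \<in> bounded_elems L"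
    and bounded_join: "\<lbrakk>a \<in> bounded_elems L; b \<in> bounded_elems L\<rbrakk> \<Longrightarrow> a \<squnion> b \<in> bounded_elems L"
    and bounded_bottom: "\<bottom> \<in> bounded_elems L"
  using bounded_ideal unfolding boolean_ideal_def by blast+

lemma bounded_meet: "\<lbrakk>a \<in> carrier L; b \<in> bounded_elems L\<rbrakk> \<Longrightarrow> a \<sqinter> b \<in> bounded_elems L"
  using bounded_down[of b "a \<sqinter> b"] bounded_closed by (simp add: meet_right)

lemma contact_sym: "\<lbrakk>a \<in> carrier L; b \<in> carrier L\<rbrakk> \<Longrightarrow> contact L a b \<longleftrightarrow> contact L b a"
  using C3 by blast

lemma contact_mono_right:
  "\<lbrakk>contact L a b; b \<sqsubseteq> b'; a \<in> carrier L; b \<in> carrier L; b' \<in> carrier L\<rbrakk> \<Longrightarrow> contact L a b'"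
  using C4[of a b b'] le_iff_meet[of b b'] by simp

lemma contact_mono:
  assumes "contact L a b" "a \<sqsubseteq> a'" "b \<sqsubseteq> b'" "a \<in> carrier L" "b \<in> carrier L" "a' \<in> carrier L" "b' \<in> carrier L"
  shows "contact L a' b'"
proof -
  have "contact L b' a" using contact_mono_right[OF assms(1,3)] assms contact_sym by blast
  then have "contact L b' a'" using contact_mono_right[of b' a a'] assms by blast
  then show ?thesis using contact_sym assms by blast
qed

lemma not_contact_bottom: "a \<in> carrier L \<Longrightarrow> \<not> contact L a \<bottom>"
  using C2[of a \<bottom>] by auto

lemma contact_of_meet:
  assumes "a \<in> carrier L" "b \<in> carrier L" "a \<sqinter> b \<noteq> \<bottom>" shows "contact L a b"
  using contact_mono[OF C1[of "a \<sqinter> b"], of a b] assms by (simp add: meet_left meet_right)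

lemma well_inside_mono:
  assumes "a \<lless> b" "a' \<sqsubseteq> a" "b \<sqsubseteq> b'" "a \<in> carrier L" "b \<in> carrier L" "a' \<in> carrier L" "b' \<in> carrier L"
  shows "a' \<lless> b'"
  using contact_mono[of a' "bcompl L b'" a "bcompl L b"] assms
  by (auto simp: well_inside_def bcompl_antimono)

lemma well_inside_le: "\<lbrakk>a \<lless> b; a \<in> carrier L; b \<in> carrier L\<rbrakk> \<Longrightarrow> a \<sqsubseteq> b"
  using contact_of_meet[of a "bcompl L b"] by (auto simp: well_inside_def le_iff_meet_bcompl)

lemma well_inside_top: "a \<in> carrier L \<Longrightarrow> a \<lless> \<top>"
  using not_contact_bottom[of a] bcompl_bcompl[of \<bottom>] by (simp add: well_inside_def bcompl_bottom)

lemma well_inside_bcompl: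
  "\<lbrakk>a \<in> carrier L; b \<in> carrier L\<rbrakk> \<Longrightarrow> bcompl L b \<lless> bcompl L a \<longleftrightarrow> a \<lless> b"
  using contact_sym[of a "bcompl L b"] by (simp add: well_inside_def)

lemma well_inside_meet_right:
  "\<lbrakk>a \<in> carrier L; b \<in> carrier L; c \<in> carrier L\<rbrakk> \<Longrightarrow> a \<lless> b \<sqinter> c \<longleftrightarrow> a \<lless> b \<and> a \<lless> c"
  by (simp add: well_inside_def bcompl_meet C4)

lemma not_contact_iff: "\<lbrakk>a \<in> carrier L; b \<in> carrier L\<rbrakk> \<Longrightarrow> \<not> contact L a b \<longleftrightarrow> a \<lless> bcompl L b"
  by (simp add: well_inside_def)

text \<open>In the algebra of regular closed sets of \<open>X\<close>, the elements with a given point in their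
  interior have these properties: a bounded member exists by local compactness, roundness is
  regularity, and the last condition says, for \<open>a\<close> contained in the interior of \<open>b\<close>, that a point
  outside \<open>a\<close> is interior to the complement of \<open>a\<close>, and a point of \<open>a\<close> is interior to \<open>b\<close>.\<close>
definition contact_end :: "'a set \<Rightarrow> bool" where
  "contact_end N \<longleftrightarrow> lattice_filter N \<and> \<bottom> \<notin> N \<and> N \<inter> bounded_elems L \<noteq> {} \<and>
     (\<forall>a\<in>N. \<exists>b\<in>N. b \<lless> a) \<and>
     (\<forall>a\<in>carrier L. \<forall>b\<in>carrier L. a \<lless> b \<longrightarrow> bcompl L a \<in> N \<or> b \<in> N)"

lemma contact_endD:
  assumes "contact_end N"
  shows contact_end_filter: "lattice_filter N" and contact_end_bottom: "\<bottom> \<notin> N"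
    and contact_end_bounded: "\<exists>a\<in>N. a \<in> bounded_elems L"
    and contact_end_round: "a \<in> N \<Longrightarrow> \<exists>b\<in>N. b \<lless> a"
    and contact_end_prime: "\<lbrakk>a \<lless> b; a \<in> carrier L; b \<in> carrier L\<rbrakk> \<Longrightarrow> bcompl L a \<in> N \<or> b \<in> N"
  using assms unfolding contact_end_def by blast+

lemma contact_end_disjoint:
  assumes "contact_end N" "a \<in> N" "bcompl L a \<in> N" shows False
proof -
  note F = lattice_filterD[OF contact_end_filter[OF assms(1)]]
  have "a \<sqinter> bcompl L a \<in> N" using F(3) assms(2,3) by blast
  then show False using meet_bcompl[OF F(1)[OF assms(2)]] contact_end_bottom[OF assms(1)] by simp
qed

text \<open>If \<open>b \<in> M\<close>, choose \<open>c \<in> M\<close> well inside \<open>b\<close>: the complement of \<open>c\<close> is not in \<open>M\<close>, let alone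
  in \<open>N\<close>, so \<open>b \<in> N\<close>.\<close>
lemma contact_end_maximal:
  assumes N: "contact_end N" and M: "contact_end M" and sub: "N \<subseteq> M" shows "N = M"
proof
  show "M \<subseteq> N"
  proof
    fix b assume b: "b \<in> M"
    then obtain c where c: "c \<in> M" "c \<lless> b" using contact_end_round[OF M] by blast
    have "b \<in> carrier L" "c \<in> carrier L" using b c lattice_filterD(1)[OF contact_end_filter[OF M]] by blast+
    then have "bcompl L c \<in> N \<or> b \<in> N" using contact_end_prime[OF N c(2)] by blast
    then show "b \<in> N" using sub contact_end_disjoint[OF M c(1)] by blast
  qed
qed (fact sub)

definition ultrafilter_end :: "'a set \<Rightarrow> 'a set" where
  "ultrafilter_end u = {a \<in> carrier L. \<exists>b\<in>u. b \<in> bounded_elems L \<and> b \<lless> a}"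

text \<open>The last defining property of a contact end is the delicate one: \<open>u\<close> contains \<open>a\<close> or \<open>a\<^sup>*\<close>,
  but \<open>a\<^sup>* \<in> u\<close> does not put \<open>a\<^sup>*\<close> into the end. Given \<open>a \<lless> b\<close>, take a bounded \<open>e\<close> with \<open>d \<lless> e\<close>
  and interpolate \<open>a \<sqinter> e \<lless> c \<lless> b\<close> with \<open>c\<close> bounded. If \<open>c \<in> u\<close>, then \<open>c\<close> witnesses that \<open>b\<close> is in
  the end. Otherwise \<open>c\<^sup>* \<sqinter> d \<in> u\<close> is bounded and well inside both \<open>(a \<sqinter> e)\<^sup>*\<close> and \<open>e\<close>, whose meet
  is below \<open>a\<^sup>*\<close>.\<close>
theorem contact_end_ultrafilter_end:
  assumes u: "ultrafilter u" and d: "d \<in> u" "d \<in> bounded_elems L"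
  shows "contact_end (ultrafilter_end u)"
proof -
  note U = ultrafilterD[OF u]
  note F = lattice_filterD[OF U(1)]
  let ?N = "ultrafilter_end u"
  have NI: "a \<in> ?N" if "b \<in> u" "b \<in> bounded_elems L" "b \<lless> a" "a \<in> carrier L" for a b
    using that by (auto simp: ultrafilter_end_def)
  have round: "\<exists>c\<in>?N. c \<in> bounded_elems L \<and> c \<lless> a" if "a \<in> ?N" for a
  proof -
    obtain b where b: "b \<in> u" "b \<in> bounded_elems L" "b \<lless> a" and a: "a \<in> carrier L"
      using \<open>a \<in> ?N\<close> by (auto simp: ultrafilter_end_def)
    then obtain c where "c \<in> bounded_elems L" "b \<lless> c" "c \<lless> a" using BC1 by blast
    then show ?thesis using NI[OF b(1,2)] bounded_closed by blast
  qed
  have "lattice_filter ?N" unfolding lattice_filter_def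
  proof (intro conjI ballI impI)
    show "?N \<noteq> {}" using NI[OF d well_inside_top] bounded_closed[OF d(2)] top_closed by blast
  next
    fix a b assume "a \<in> ?N" and b: "b \<in> carrier L" "a \<sqsubseteq> b"
    then obtain c where c: "c \<in> u" "c \<in> bounded_elems L" "c \<lless> a" "a \<in> carrier L"
      by (auto simp: ultrafilter_end_def)
    have "c \<lless> b" using well_inside_mono[OF c(3) _ b(2)] bounded_closed[OF c(2)] c(4) b(1) le_refl by blast
    then show "b \<in> ?N" using NI c b by blast
  next
    fix a b assume "a \<in> ?N" "b \<in> ?N"
    then obtain c e where c: "c \<in> u" "c \<in> bounded_elems L" "c \<lless> a" "a \<in> carrier L"
      and e: "e \<in> u" "e \<in> bounded_elems L" "e \<lless> b" "b \<in> carrier L" unfolding ultrafilter_end_def by blast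
    have ce: "c \<in> carrier L" "e \<in> carrier L" using c e bounded_closed by blast+
    have "c \<sqinter> e \<lless> a" "c \<sqinter> e \<lless> b"
      using well_inside_mono[OF c(3), of "c \<sqinter> e" a] well_inside_mono[OF e(3), of "c \<sqinter> e" b] c e ce
      by (simp_all add: meet_left meet_right)
    then show "a \<sqinter> b \<in> ?N"
      using NI[OF F(3)[OF c(1) e(1)] bounded_meet[OF ce(1) e(2)]] c e ce
        by (simp add: well_inside_meet_right)
  qed (auto simp: ultrafilter_end_def)
  moreover have "\<bottom> \<notin> ?N"
  proof
    assume "\<bottom> \<in> ?N"
    then obtain b where b: "b \<in> u" "b \<in> bounded_elems L" "b \<lless> \<bottom>" by (auto simp: ultrafilter_end_def)
    then have "b = \<bottom>" using well_inside_le[OF b(3)] bounded_closed le_bottom by simp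
    then show False using b U(2) by simp
  qed
  moreover have "?N \<inter> bounded_elems L \<noteq> {}"
    using round[OF NI[OF d well_inside_top]] bounded_closed[OF d(2)] top_closed by blast
  moreover have "bcompl L a \<in> ?N \<or> b \<in> ?N" if ab: "a \<in> carrier L" "b \<in> carrier L" "a \<lless> b" for a b
  proof -
    have dc: "d \<in> carrier L" using d bounded_closed by blast
    obtain e where e: "e \<in> bounded_elems L" "d \<lless> e" using BC1[OF d(2) top_closed well_inside_top[OF dc]] by blast
    have ec: "e \<in> carrier L" using e bounded_closed by blast
    have "a \<sqinter> e \<lless> b" using well_inside_mono[OF ab(3), of "a \<sqinter> e" b] ab ec by (simp add: meet_left)
    then obtain c where c: "c \<in> bounded_elems L" "a \<sqinter> e \<lless> c" "c \<lless> b"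
      using BC1[OF bounded_meet[OF ab(1) e(1)] ab(2)] by blast
    have cc: "c \<in> carrier L" using c bounded_closed by blast
    show ?thesis
    proof (cases "c \<in> u")
      case True
      then show ?thesis using NI[OF _ c(1,3) ab(2)] by blast
    next
      case False
      then have nc: "bcompl L c \<in> u" using U(3) cc by blast
      \<comment> \<open>Meeting with \<open>d\<close> makes the witness bounded.\<close>
      let ?g = "bcompl L c \<sqinter> d"
      have g: "?g \<in> u" "?g \<in> bounded_elems L" "?g \<in> carrier L"
        using F(3)[OF nc d(1)] bounded_meet[OF _ d(2)] cc dc by simp_all
      have "bcompl L c \<lless> bcompl L (a \<sqinter> e)" using c ab ec cc by (simp add: well_inside_bcompl)
      then have "?g \<lless> bcompl L (a \<sqinter> e)"
        using well_inside_mono[of "bcompl L c" "bcompl L (a \<sqinter> e)" ?g "bcompl L (a \<sqinter> e)"] ab ec cc dc g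
          by (simp add: meet_left)
      moreover have "?g \<lless> e"
        using well_inside_mono[OF e(2), of ?g e] ec cc dc g by (simp add: meet_right)
      ultimately have "?g \<lless> bcompl L (a \<sqinter> e) \<sqinter> e" using g ab ec by (simp add: well_inside_meet_right)
      moreover have "bcompl L (a \<sqinter> e) \<sqinter> e \<sqsubseteq> bcompl L a"
      proof -
        have "bcompl L (a \<sqinter> e) \<sqinter> e \<sqinter> a = bcompl L (a \<sqinter> e) \<sqinter> (a \<sqinter> e)"
          using ab ec by (simp add: meet_assoc meet_commute[of e a])
        also have "\<dots> = \<bottom>" using meet_bcompl[of "a \<sqinter> e"] ab ec by (simp add: meet_commute)
        finally show ?thesis using ab ec by (simp add: meet_eq_bottom_iff)
      qed
      ultimately have "?g \<lless> bcompl L a"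
        using well_inside_mono[of ?g "bcompl L (a \<sqinter> e) \<sqinter> e" ?g "bcompl L a"] g ab ec by simp
      then show ?thesis using NI[OF g(1,2)] ab by simp
    qed
  qed
  ultimately show ?thesis unfolding contact_end_def using round by blast
qed

lemma bcompl_notin_ultrafilter_end:
  assumes "ultrafilter u" "a \<in> u" shows "bcompl L a \<notin> ultrafilter_end u"
proof
  note F = lattice_filterD[OF ultrafilterD(1)[OF assms(1)]]
  have a: "a \<in> carrier L" using F(1) assms by blast
  assume "bcompl L a \<in> ultrafilter_end u"
  then obtain b where b: "b \<in> u" "b \<lless> bcompl L a" by (auto simp: ultrafilter_end_def)
  have bc: "b \<in> carrier L" using F(1) b by blast
  have "b \<sqinter> a = \<bottom>" using well_inside_le[OF b(2)] a bc by (simp add: meet_eq_bottom_iff)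
  then show False using F(3)[OF b(1) assms(2)] ultrafilterD(2)[OF assms(1)] by simp
qed

text \<open>The elements not in contact with \<open>a\<close> form an ideal; by (BC2) it misses some bounded \<open>c \<sqinter> b\<close>.
  An ultrafilter that contains \<open>c \<sqinter> b\<close> and avoids this ideal induces the desired end.\<close>
theorem contact_end_exists:
  assumes a: "a \<in> carrier L" and b: "b \<in> carrier L" and ab: "contact L a b"
  obtains N where "contact_end N" "bcompl L a \<notin> N" "bcompl L b \<notin> N"
proof -
  obtain c where c: "c \<in> bounded_elems L" "contact L a (c \<sqinter> b)" using BC2[OF a b ab] by blast
  have cc: "c \<in> carrier L" using c bounded_closed by blast
  let ?c = "c \<sqinter> b"
  define I where "I = {x \<in> carrier L. \<not> contact L a x}"
  have I: "boolean_ideal L I" unfolding boolean_ideal_def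
  proof (intro conjI ballI impI)
    show "x \<in> I" if "x \<in> carrier L" "y \<in> I" "x \<sqsubseteq> y" for x y
      using that contact_mono_right[of a x y] a by (auto simp: I_def)
  qed (auto simp: I_def not_contact_bottom a C4)
  have disj: "{x \<in> carrier L. ?c \<sqsubseteq> x} \<inter> I = {}"
    using contact_mono_right[OF c(2)] a b cc by (auto simp: I_def)
  obtain u where u: "ultrafilter u" "{x \<in> carrier L. ?c \<sqsubseteq> x} \<subseteq> u" "u \<inter> I = {}"
    using ultrafilter_separation[OF lattice_filter_principal I disj] b cc by auto
  have cu: "?c \<in> u" "b \<in> u" using u(2) b cc by (auto simp: meet_right)
  have N: "contact_end (ultrafilter_end u)"
    using contact_end_ultrafilter_end[OF u(1) cu(1)] bounded_meet[OF b c(1)] by (simp add: meet_commute)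
  moreover have "bcompl L a \<notin> ultrafilter_end u"
  proof
    assume "bcompl L a \<in> ultrafilter_end u"
    then obtain x where x: "x \<in> u" "x \<in> bounded_elems L" "x \<lless> bcompl L a"
      by (auto simp: ultrafilter_end_def)
    then have "x \<in> I" using bounded_closed[OF x(2)] a not_contact_iff[of x a] contact_sym[of x a]
      by (simp add: I_def)
    then show False using u(3) x(1) by blast
  qed
  moreover have "bcompl L b \<notin> ultrafilter_end u" by (rule bcompl_notin_ultrafilter_end[OF u(1) cu(2)])
  ultimately show thesis using that by blast
qed

end

section \<open>Representability of complete local contact algebras\<close>

text \<open>Points are elements of an arbitrary set \<open>P\<close> in bijection with the contact ends, rather than
  the ends themselves, so that the space can live on any sufficiently large type.\<close>
locale end_space = local_contact_algebra L + complete_lattice L for L :: "'a local_contact_structure" (structure) +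
  fixes P :: "'p set" and N :: "'p \<Rightarrow> 'a set"
  assumes N_bij: "bij_betw N P {N. contact_end N}"
begin

lemma end_N: "p \<in> P \<Longrightarrow> contact_end (N p)"
  using N_bij bij_betwE by blast

lemma N_filter:
  assumes "p \<in> P"
  shows N_closed: "a \<in> N p \<Longrightarrow> a \<in> carrier L" and N_up: "\<lbrakk>a \<in> N p; a \<sqsubseteq> b; b \<in> carrier L\<rbrakk> \<Longrightarrow> b \<in> N p"
    and N_meet: "\<lbrakk>a \<in> N p; b \<in> N p\<rbrakk> \<Longrightarrow> a \<sqinter> b \<in> N p"
  using lattice_filterD[OF contact_end_filter[OF end_N[OF assms]]] by blast+

lemma N_meet_iff:
  assumes "p \<in> P" "a \<in> carrier L" "b \<in> carrier L" shows "a \<sqinter> b \<in> N p \<longleftrightarrow> a \<in> N p \<and> b \<in> N p"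
  using N_up[OF assms(1), of "a \<sqinter> b"] N_meet[OF assms(1)] assms(2,3) meet_left meet_right by blast

lemma top_in_N: assumes "p \<in> P" shows "\<top> \<in> N p"
proof -
  obtain a where "a \<in> N p" using contact_end_bounded[OF end_N[OF assms]] by blast
  then show ?thesis using N_up[OF assms, of a \<top>] N_closed[OF assms] by simp
qed

text \<open>\<open>U a\<close> and \<open>S a\<close> will be the interior of the regular closed set that corresponds to \<open>a\<close>, and
  this set itself.\<close>
definition U :: "'a \<Rightarrow> 'p set" where "U a = {p \<in> P. a \<in> N p}"
definition S :: "'a \<Rightarrow> 'p set" where "S a = {p \<in> P. bcompl L a \<notin> N p}"
definition T :: "'p topology" where
  "T = topology (\<lambda>V. V \<subseteq> P \<and> (\<forall>p\<in>V. \<exists>a\<in>N p. U a \<subseteq> V))"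

lemma U_meet: "\<lbrakk>a \<in> carrier L; b \<in> carrier L\<rbrakk> \<Longrightarrow> U (a \<sqinter> b) = U a \<inter> U b"
  using N_meet_iff by (auto simp: U_def)

lemma openin_T: "openin T V \<longleftrightarrow> V \<subseteq> P \<and> (\<forall>p\<in>V. \<exists>a\<in>N p. U a \<subseteq> V)"
proof -
  have "istopology (\<lambda>V. V \<subseteq> P \<and> (\<forall>p\<in>V. \<exists>a\<in>N p. U a \<subseteq> V))"
    unfolding istopology_def
  proof (intro conjI allI impI ballI)
    fix V W p assume V: "V \<subseteq> P \<and> (\<forall>p\<in>V. \<exists>a\<in>N p. U a \<subseteq> V)" and W: "W \<subseteq> P \<and> (\<forall>p\<in>W. \<exists>a\<in>N p. U a \<subseteq> W)"
      and p: "p \<in> V \<inter> W"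
    then obtain a b where a: "a \<in> N p" "U a \<subseteq> V" and b: "b \<in> N p" "U b \<subseteq> W" by blast
    have pP: "p \<in> P" using V p by blast
    have "U (a \<sqinter> b) \<subseteq> V \<inter> W" using U_meet[OF N_closed[OF pP a(1)] N_closed[OF pP b(1)]] a b by blast
    then show "\<exists>c\<in>N p. U c \<subseteq> V \<inter> W" using N_meet[OF pP a(1) b(1)] by blast
  next
    fix \<K> p assume K: "\<forall>K\<in>\<K>. K \<subseteq> P \<and> (\<forall>p\<in>K. \<exists>a\<in>N p. U a \<subseteq> K)" and "p \<in> \<Union>\<K>"
    then obtain K where "K \<in> \<K>" "p \<in> K" by blast
    then obtain a where "a \<in> N p" "U a \<subseteq> K" using K by blast
    then show "\<exists>a\<in>N p. U a \<subseteq> \<Union>\<K>" using \<open>K \<in> \<K>\<close> by blast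
  qed blast+
  then show ?thesis by (simp add: T_def)
qed

lemma openin_U: "openin T (U a)"
  unfolding openin_T by (auto simp: U_def)

lemma topspace_T: "topspace T = P"
proof
  show "topspace T \<subseteq> P" using openin_T openin_topspace by blast
  have "P = U \<top>" using top_in_N by (auto simp: U_def)
  then show "P \<subseteq> topspace T" using openin_U openin_subset by metis
qed

lemma P_minus_S: "P - S a = U (bcompl L a)"
  by (auto simp: U_def S_def)

lemma closedin_S: "closedin T (S a)"
  using openin_U[of "bcompl L a"] P_minus_S[of a] by (auto simp: closedin_def topspace_T S_def)

lemma U_subset_S: "U a \<subseteq> S a"
  using contact_end_disjoint end_N by (auto simp: U_def S_def)

lemma S_join: "\<lbrakk>a \<in> carrier L; b \<in> carrier L\<rbrakk> \<Longrightarrow> S (a \<squnion> b) = S a \<union> S b"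
  by (auto simp: S_def bcompl_join N_meet_iff)

lemma S_bottom: "S \<bottom> = {}"
  by (auto simp: S_def bcompl_bottom top_in_N)

lemma S_mono: "\<lbrakk>a \<sqsubseteq> b; a \<in> carrier L; b \<in> carrier L\<rbrakk> \<Longrightarrow> S a \<subseteq> S b"
  using S_join[of a b] le_iff_meet[of a b] by auto

lemma U_mono: "\<lbrakk>a \<sqsubseteq> b; a \<in> carrier L; b \<in> carrier L\<rbrakk> \<Longrightarrow> U a \<subseteq> U b"
  using N_up by (auto simp: U_def)

lemma S_subset_U: "\<lbrakk>a \<lless> b; a \<in> carrier L; b \<in> carrier L\<rbrakk> \<Longrightarrow> S a \<subseteq> U b"
  using contact_end_prime end_N by (auto simp: S_def U_def)

lemma contact_iff_S:
  assumes "a \<in> carrier L" "b \<in> carrier L" shows "contact L a b \<longleftrightarrow> S a \<inter> S b \<noteq> {}"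
proof
  assume "contact L a b"
  then obtain M where M: "contact_end M" "bcompl L a \<notin> M" "bcompl L b \<notin> M"
    using contact_end_exists assms by blast
  then obtain p where "p \<in> P" "N p = M" using N_bij by (metis bij_betw_iff_bijections mem_Collect_eq)
  then show "S a \<inter> S b \<noteq> {}" using M by (auto simp: S_def)
next
  assume ne: "S a \<inter> S b \<noteq> {}"
  show "contact L a b"
  proof (rule ccontr)
    assume "\<not> contact L a b"
    then have "S a \<subseteq> U (bcompl L b)" using assms not_contact_iff[of a b] S_subset_U by simp
    then show False using ne P_minus_S[of b] by blast
  qed
qed

lemma S_nonempty: "\<lbrakk>a \<in> carrier L; a \<noteq> \<bottom>\<rbrakk> \<Longrightarrow> S a \<noteq> {}"
  using contact_iff_S[of a a] C1[of a] by blast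

lemma U_nonempty:
  assumes "a \<in> carrier L" "a \<noteq> \<bottom>" shows "U a \<noteq> {}"
proof -
  obtain b where b: "b \<in> bounded_elems L" "b \<noteq> \<bottom>" "b \<lless> a" using BC3[OF assms] by blast
  then show ?thesis using S_nonempty[of b] S_subset_U[of b a] bounded_closed[of b] assms by blast
qed

text \<open>If \<open>a\<close> is not below \<open>b\<close>, then \<open>a \<sqinter> b\<^sup>*\<close> has a point by (BC3), and this point separates \<open>S a\<close>
  from \<open>S b\<close>.\<close>
lemma le_iff_S:
  assumes "a \<in> carrier L" "b \<in> carrier L" shows "a \<sqsubseteq> b \<longleftrightarrow> S a \<subseteq> S b"
proof
  assume sub: "S a \<subseteq> S b"
  have "U (a \<sqinter> bcompl L b) \<subseteq> S a \<inter> (P - S b)"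
    using assms U_subset_S[of a] by (auto simp: U_meet P_minus_S)
  then have "a \<sqinter> bcompl L b = \<bottom>" using sub U_nonempty[of "a \<sqinter> bcompl L b"] assms by auto
  then show "a \<sqsubseteq> b" using assms le_iff_meet_bcompl by blast
qed (use assms S_mono in blast)

lemma closure_of_U:
  assumes a: "a \<in> carrier L" shows "T closure_of (U a) = S a"
proof
  show "T closure_of (U a) \<subseteq> S a" by (simp add: closure_of_minimal U_subset_S closedin_S)
  show "S a \<subseteq> T closure_of (U a)"
  proof
    fix p assume p: "p \<in> S a"
    then have pP: "p \<in> P" by (simp add: S_def)
    show "p \<in> T closure_of (U a)" unfolding in_closure_of
    proof (intro conjI allI impI)
      fix V assume "p \<in> V \<and> openin T V"
      then obtain b where b: "b \<in> N p" "U b \<subseteq> V" by (auto simp: openin_T)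
      have bc: "b \<in> carrier L" using N_closed[OF pP b(1)] .
      have "a \<sqinter> b \<noteq> \<bottom>"
      proof
        assume "a \<sqinter> b = \<bottom>"
        then have "b \<sqsubseteq> bcompl L a" using meet_eq_bottom_iff[of b a] a bc by (simp add: meet_commute)
        then have "bcompl L a \<in> N p" using N_up[OF pP b(1)] a by simp
        then show False using p by (simp add: S_def)
      qed
      then have "U a \<inter> U b \<noteq> {}" using U_nonempty[of "a \<sqinter> b"] a bc by (simp add: U_meet)
      then show "\<exists>y. y \<in> U a \<and> y \<in> V" using b by blast
    qed (simp add: topspace_T pP)
  qed
qed

lemma interior_of_S:
  assumes a: "a \<in> carrier L" shows "T interior_of (S a) = U a"
proof -
  have "T interior_of (S a) = P - S (bcompl L a)"
    using closure_of_U[of "bcompl L a"] a by (simp add: interior_of_closure_of topspace_T P_minus_S)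
  then show ?thesis using a by (simp add: P_minus_S)
qed

lemma regular_closed_S: "a \<in> carrier L \<Longrightarrow> regular_closed T (S a)"
  by (simp add: regular_closed_def interior_of_S closure_of_U)

text \<open>Completeness enters here: \<open>F\<close> corresponds to the join \<open>a\<close> of all \<open>b\<close> with \<open>U b\<close> inside the
  interior of \<open>F\<close>. A basic open set \<open>U d\<close> that misses this interior has \<open>d\<close> disjoint from all such
  \<open>b\<close>, hence from \<open>a\<close>; so the interior is dense in \<open>S a\<close>.\<close>
lemma regular_closed_imp_S:
  assumes F: "regular_closed T F" shows "\<exists>a\<in>carrier L. S a = F"
proof -
  let ?V = "T interior_of F"
  define \<B> where "\<B> = {b \<in> carrier L. U b \<subseteq> ?V}"
  define a where "a = \<Squnion>\<B>"
  have \<B>: "\<B> \<subseteq> carrier L" by (auto simp: \<B>_def)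
  then have a: "a \<in> carrier L" by (simp add: a_def)
  have V: "openin T ?V" by simp
  have le_a: "b \<sqsubseteq> a" if "b \<in> \<B>" for b using sup_upper[OF \<B> that] by (simp add: a_def)
  have "?V \<subseteq> S a"
  proof
    fix p assume p: "p \<in> ?V"
    then obtain b where b: "b \<in> N p" "U b \<subseteq> ?V" "p \<in> P" using V unfolding openin_T by blast
    then have "b \<in> \<B>" using N_closed by (auto simp: \<B>_def)
    then have "U b \<subseteq> U a" using le_a \<B> a U_mono by blast
    then show "p \<in> S a" using b U_subset_S[of a] by (auto simp: U_def)
  qed
  then have "F \<subseteq> S a" using regular_closed_subset_iff[OF F closedin_S] by blast
  moreover have "S a \<subseteq> F"
  proof
    fix p assume p: "p \<in> S a"
    then have pP: "p \<in> P" by (simp add: S_def)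
    have "p \<in> T closure_of ?V" unfolding in_closure_of
    proof (intro conjI allI impI)
      fix W assume "p \<in> W \<and> openin T W"
      then obtain d where d: "d \<in> N p" "U d \<subseteq> W" by (auto simp: openin_T)
      have dc: "d \<in> carrier L" using N_closed[OF pP d(1)] .
      show "\<exists>y. y \<in> ?V \<and> y \<in> W"
      proof (rule ccontr)
        assume disj: "\<not> ?thesis"
        have "b \<sqsubseteq> bcompl L d" if b: "b \<in> \<B>" for b
        proof -
          have bc: "b \<in> carrier L" using b \<B> by blast
          have "U (b \<sqinter> d) = {}" using disj d b bc dc by (auto simp: U_meet \<B>_def)
          then have "b \<sqinter> d = \<bottom>" using U_nonempty[of "b \<sqinter> d"] bc dc by auto
          then show ?thesis using meet_eq_bottom_iff bc dc by blast
        qed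
        then have "a \<sqsubseteq> bcompl L d" using sup_least[OF \<B>, of "bcompl L d"] dc by (simp add: a_def)
        then have "p \<in> S (bcompl L d)" using S_mono[of a "bcompl L d"] p a dc by auto
        then show False using d dc by (simp add: S_def)
      qed
    qed (simp add: topspace_T pP)
    then show "p \<in> F" using F by (simp add: regular_closed_def)
  qed
  ultimately show ?thesis using a by blast
qed

text \<open>The elements \<open>x\<close> for which finitely many members of the cover suffice to cover \<open>S x\<close> form an
  ideal. If \<open>a\<close> is not among them, some ultrafilter \<open>u\<close> contains \<open>a\<close> and avoids the ideal. Its end
  lies in \<open>S a\<close>, so in \<open>U b\<close> for some \<open>U b\<close> inside a member of the cover; but then some \<open>c \<in> u\<close> is
  well inside \<open>b\<close>, and \<open>S c \<subseteq> U b\<close> puts \<open>c\<close> into the ideal.\<close>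
lemma compactin_S:
  assumes a: "a \<in> bounded_elems L" shows "compactin T (S a)"
  unfolding compactin_def
proof (intro conjI allI impI)
  show "S a \<subseteq> topspace T" by (auto simp: S_def topspace_T)
  fix \<U> assume "Ball \<U> (openin T) \<and> S a \<subseteq> \<Union>\<U>"
  then have \<U>: "\<And>V. V \<in> \<U> \<Longrightarrow> openin T V" and cover: "S a \<subseteq> \<Union>\<U>" by auto
  have ac: "a \<in> carrier L" using a bounded_closed by blast
  define I where "I = {x \<in> carrier L. \<exists>\<F>. finite \<F> \<and> \<F> \<subseteq> \<U> \<and> S x \<subseteq> \<Union>\<F>}"
  have I: "boolean_ideal L I" unfolding boolean_ideal_def
  proof (intro conjI ballI impI)
    show "I \<subseteq> carrier L" by (auto simp: I_def)
    show "\<bottom> \<in> I" by (auto simp: I_def S_bottom)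
    show "x \<in> I" if "x \<in> carrier L" "y \<in> I" "x \<sqsubseteq> y" for x y
      using that S_mono[of x y] unfolding I_def by blast
    show "x \<squnion> y \<in> I" if xy: "x \<in> I" "y \<in> I" for x y
    proof -
      obtain \<F> where F: "finite \<F>" "\<F> \<subseteq> \<U>" "S x \<subseteq> \<Union>\<F>" "x \<in> carrier L" using xy(1) by (auto simp: I_def)
      obtain \<G> where G: "finite \<G>" "\<G> \<subseteq> \<U>" "S y \<subseteq> \<Union>\<G>" "y \<in> carrier L" using xy(2) by (auto simp: I_def)
      have "finite (\<F> \<union> \<G>) \<and> \<F> \<union> \<G> \<subseteq> \<U> \<and> S (x \<squnion> y) \<subseteq> \<Union>(\<F> \<union> \<G>)"
        using F G by (auto simp: S_join)
      moreover have "x \<squnion> y \<in> carrier L" using F G by simp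
      ultimately show ?thesis unfolding I_def by blast
    qed
  qed
  show "\<exists>\<F>. finite \<F> \<and> \<F> \<subseteq> \<U> \<and> S a \<subseteq> \<Union>\<F>"
  proof (rule ccontr)
    assume "\<not> ?thesis"
    then have "a \<notin> I" by (auto simp: I_def)
    have "{x \<in> carrier L. a \<sqsubseteq> x} \<inter> I = {}"
    proof -
      have "a \<in> I" if "x \<in> I" "a \<sqsubseteq> x" for x using that I ac unfolding boolean_ideal_def by blast
      then show ?thesis using \<open>a \<notin> I\<close> by blast
    qed
    then obtain u where u: "ultrafilter u" "{x \<in> carrier L. a \<sqsubseteq> x} \<subseteq> u" "u \<inter> I = {}"
      using ultrafilter_separation[OF lattice_filter_principal[OF ac] I] by blast
    have au: "a \<in> u" using u(2) ac by auto
    obtain p where p: "p \<in> P" "N p = ultrafilter_end u"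
      using contact_end_ultrafilter_end[OF u(1) au a] N_bij
        by (metis bij_betw_iff_bijections mem_Collect_eq)
    have "p \<in> S a" using p bcompl_notin_ultrafilter_end[OF u(1) au] by (simp add: S_def)
    then obtain V where V: "V \<in> \<U>" "p \<in> V" using cover by blast
    then obtain b where b: "b \<in> N p" "U b \<subseteq> V" using \<U>[OF V(1)] unfolding openin_T by blast
    then obtain c where c: "c \<in> u" "c \<in> bounded_elems L" "c \<lless> b" "b \<in> carrier L"
      using p(2) by (auto simp: ultrafilter_end_def)
    have "S c \<subseteq> V" using S_subset_U[OF c(3)] c(4) bounded_closed[OF c(2)] b(2) by blast
    then have "c \<in> I" using V(1) bounded_closed[OF c(2)] unfolding I_def
      by (intro CollectI conjI exI[of _ "{V}"]) auto
    then show False using c(1) u(3) by blast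
  qed
qed

lemma bounded_finite_upper_bound:
  assumes "finite F" "F \<subseteq> bounded_elems L" shows "\<exists>b\<in>bounded_elems L. \<forall>c\<in>F. c \<sqsubseteq> b"
  using assms
proof (induction F)
  case empty
  then show ?case using bounded_bottom by blast
next
  case (insert c F)
  then obtain b where b: "b \<in> bounded_elems L" "\<forall>c\<in>F. c \<sqsubseteq> b" and c: "c \<in> bounded_elems L" by auto
  have bc: "b \<in> carrier L" "c \<in> carrier L" using b c bounded_closed by blast+
  have "e \<sqsubseteq> c \<squnion> b" if e: "e \<in> F" for e
  proof -
    have ec: "e \<in> carrier L" using e insert.prems bounded_closed by blast
    have "e \<sqsubseteq> b" using b e by blast
    then show ?thesis using le_trans[of e b "c \<squnion> b"] join_right[of c b] bc ec by simp
  qed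
  then have "\<forall>e\<in>insert c F. e \<sqsubseteq> c \<squnion> b" using join_left[of c b] bc by simp
  then show ?case using bounded_join[OF c b(1)] by blast
qed

lemma bounded_iff_compactin_S:
  assumes a: "a \<in> carrier L" shows "a \<in> bounded_elems L \<longleftrightarrow> compactin T (S a)"
proof
  assume comp: "compactin T (S a)"
  have "S a \<subseteq> \<Union>(U ` bounded_elems L)"
  proof
    fix p assume "p \<in> S a"
    then have p: "p \<in> P" by (simp add: S_def)
    then show "p \<in> \<Union>(U ` bounded_elems L)" using contact_end_bounded[OF end_N[OF p]]
      by (auto simp: U_def)
  qed
  then obtain \<F> where "finite \<F>" "\<F> \<subseteq> U ` bounded_elems L" "S a \<subseteq> \<Union>\<F>"
    using compactinD[OF comp, of "U ` bounded_elems L"] openin_U by blast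
  then obtain F where F: "finite F" "F \<subseteq> bounded_elems L" "S a \<subseteq> \<Union>(U ` F)"
    using finite_subset_image by metis
  obtain b where b: "b \<in> bounded_elems L" "\<forall>c\<in>F. c \<sqsubseteq> b" using bounded_finite_upper_bound[OF F(1,2)] by blast
  have "U c \<subseteq> S b" if "c \<in> F" for c
    using U_subset_S[of c] S_mono[of c b] b that F(2) bounded_closed by blast
  then have "S a \<subseteq> S b" using F(3) by blast
  then have "a \<sqsubseteq> b" using le_iff_S[OF a bounded_closed[OF b(1)]] by blast
  then show "a \<in> bounded_elems L" using bounded_down b a by blast
qed (rule compactin_S)

lemma locally_compact_T: "locally_compact_space T"
  unfolding locally_compact_space_def
proof
  fix p assume "p \<in> topspace T"
  then have p: "p \<in> P" by (simp add: topspace_T)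
  then obtain a where a: "a \<in> N p" "a \<in> bounded_elems L" using contact_end_bounded end_N by blast
  then show "\<exists>V K. openin T V \<and> compactin T K \<and> p \<in> V \<and> V \<subseteq> K"
    using openin_U[of a] compactin_S[OF a(2)] U_subset_S[of a] p
    by (intro exI[of _ "U a"] exI[of _ "S a"]) (auto simp: U_def)
qed

lemma Hausdorff_T: "Hausdorff_space T"
  unfolding Hausdorff_space_def topspace_T
proof (intro allI impI)
  have sep: "\<exists>V W. openin T V \<and> openin T W \<and> p \<in> V \<and> q \<in> W \<and> disjnt V W"
    if p: "p \<in> P" and q: "q \<in> P" and a: "a \<in> N p" "a \<notin> N q" for p q a
  proof -
    obtain b where b: "b \<in> N p" "b \<lless> a" using contact_end_round[OF end_N[OF p] a(1)] by blast
    have c: "a \<in> carrier L" "b \<in> carrier L" using N_closed[OF p] a b by blast+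
    then have "bcompl L b \<in> N q" using contact_end_prime[OF end_N[OF q] b(2)] a by blast
    then have "p \<in> U b" "q \<in> U (bcompl L b)" using p q b by (auto simp: U_def)
    moreover have "disjnt (U b) (U (bcompl L b))"
      using U_subset_S[of b] P_minus_S[of b] by (auto simp: disjnt_iff)
    ultimately show ?thesis using openin_U by blast
  qed
  fix p q assume pq: "p \<in> P \<and> q \<in> P \<and> p \<noteq> q"
  then have "N p \<noteq> N q" using N_bij by (metis bij_betw_inv_into_left)
  then have "\<not> N p \<subseteq> N q" using contact_end_maximal[of "N p" "N q"] end_N pq by blast
  then show "\<exists>V W. openin T V \<and> openin T W \<and> p \<in> V \<and> q \<in> W \<and> disjnt V W"
    using sep pq by blast
qed

theorem end_space_representation: "regular_closed_representation T L S"
proof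
  show "bij_betw S (carrier L) {F. regular_closed T F}"
    unfolding bij_betw_def
  proof
    show "inj_on S (carrier L)"
      by (rule inj_onI) (metis le_antisym le_iff_S order_refl)
    show "S ` carrier L = {F. regular_closed T F}"
      using regular_closed_S regular_closed_imp_S by blast
  qed
  show "bounded_elems L = {a \<in> carrier L. compactin T (S a)}"
    using bounded_iff_compactin_S bounded_closed by blast
qed (simp_all add: locally_compact_T Hausdorff_T eq_is_equal le_iff_S contact_iff_S)

end

text \<open>Roeper's theorem. The bound on the size of the set of points comes from ends being sets of
  elements of the algebra.\<close>
theorem complete_local_contact_algebra_representable:
  fixes A :: "'e local_contact_structure"
  assumes A: "complete_local_contact_algebra A" and P: "Pow (carrier A) \<lesssim> (Q :: 'p set)"
  obtains X :: "'p topology" and s where "regular_closed_representation X A s" "topspace X \<subseteq> Q"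
proof -
  interpret A: local_contact_algebra A using A by (simp add: complete_local_contact_algebra_def)
  obtain i where i: "inj_on i (Pow (carrier A))" "i ` Pow (carrier A) \<subseteq> Q"
    using P by (auto simp: lepoll_def)
  let ?E = "{N. A.contact_end N}"
  have E: "?E \<subseteq> Pow (carrier A)" using A.lattice_filterD(1) A.contact_end_filter by blast
  interpret end_space A "i ` ?E" "inv_into ?E i"
  proof (rule end_space.intro)
    show "local_contact_algebra A" "complete_lattice A"
      using A by (simp_all add: complete_local_contact_algebra_def)
    show "end_space_axioms A (i ` ?E) (inv_into ?E i)"
      using inj_on_imp_bij_betw[OF inj_on_subset[OF i(1) E]] bij_betw_inv_into
      by (auto simp: end_space_axioms_def)
  qed
  show thesis
    using that[OF end_space_representation] topspace_T i E by blast
qed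

section \<open>Fully faithful and essentially surjective functors\<close>

lemma category_opposite:
  assumes "category C" shows "category (opposite C)"
proof -
  interpret category C by fact
  show ?thesis
    by standard (auto simp: opposite_def Id_in_Hom Comp_in_Hom Comp_Id_left Comp_Id_right Comp_assoc)
qed

lemma isomorphismsI:
  assumes "f \<in> Hom C X Y" "g \<in> Hom C Y X" "Comp C X Y X g f = Id C X" "Comp C Y X Y f g = Id C Y"
  shows "f \<in> isomorphisms C X Y"
  using assms unfolding isomorphisms_def by blast

text \<open>Choose for every \<open>B\<close> an object \<open>g B\<close> and an isomorphism \<open>e B\<close> from \<open>F (g B)\<close> to \<open>B\<close>. The
  quasi-inverse sends \<open>h\<close> to the unique morphism that \<open>F\<close> maps to the conjugate of \<open>h\<close> by these
  isomorphisms, and all equations hold because they hold after applying \<open>F\<close>.\<close>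
theorem equivalent_if_fully_faithful_essentially_surjective:
  assumes C: "category C" and D: "category D" and F: "is_functor C D F"
    and ff: "\<And>X Y. \<lbrakk>X \<in> Obj C; Y \<in> Obj C\<rbrakk> \<Longrightarrow>
      bij_betw (fmor F X Y) (Hom C X Y) (Hom D (fobj F X) (fobj F Y))"
    and es: "\<And>B. B \<in> Obj D \<Longrightarrow> \<exists>X\<in>Obj C. isomorphisms D (fobj F X) B \<noteq> {}"
  shows "equivalent C D"
proof -
  interpret C: category C by fact
  interpret D: category D by fact
  let ?o = "fobj F" and ?m = "fmor F"
  have Fo: "?o X \<in> Obj D" if "X \<in> Obj C" for X using F that by (simp add: is_functor_def)
  have Fm: "?m X Y f \<in> Hom D (?o X) (?o Y)" if "X \<in> Obj C" "Y \<in> Obj C" "f \<in> Hom C X Y" for X Y f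
    using F that by (simp add: is_functor_def)
  have FId: "?m X X (Id C X) = Id D (?o X)" if "X \<in> Obj C" for X using F that
    by (simp add: is_functor_def)
  have FComp: "?m X Z (Comp C X Y Z g f) = Comp D (?o X) (?o Y) (?o Z) (?m Y Z g) (?m X Y f)"
    if "X \<in> Obj C" "Y \<in> Obj C" "Z \<in> Obj C" "f \<in> Hom C X Y" "g \<in> Hom C Y Z" for X Y Z f g
    using F that by (simp add: is_functor_def)
  define lift where "lift X Y = inv_into (Hom C X Y) (?m X Y)" for X Y
  have lift: "lift X Y h \<in> Hom C X Y" "?m X Y (lift X Y h) = h"
    if "X \<in> Obj C" "Y \<in> Obj C" "h \<in> Hom D (?o X) (?o Y)" for X Y h
    using ff[OF that(1,2)] that(3) unfolding lift_def
    by (metis bij_betw_imp_surj_on inv_into_into, metis bij_betw_inv_into_right)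
  \<comment> \<open>Every equation in \<open>C\<close> below is proved by applying this to the two sides.\<close>
  have faithful: "f = g"
    if "X \<in> Obj C" "Y \<in> Obj C" "f \<in> Hom C X Y" "g \<in> Hom C X Y" "?m X Y f = ?m X Y g" for X Y f g
    using ff[OF that(1,2)] that(3-) by (auto simp: bij_betw_def inj_on_def)
  have "\<forall>B\<in>Obj D. \<exists>X e e'. X \<in> Obj C \<and> e \<in> Hom D (?o X) B \<and> e' \<in> Hom D B (?o X) \<and>
      Comp D (?o X) B (?o X) e' e = Id D (?o X) \<and> Comp D B (?o X) B e e' = Id D B"
    using es by (fastforce simp: isomorphisms_def)
  then obtain g e e' where gee: "\<And>B. B \<in> Obj D \<Longrightarrow> g B \<in> Obj C \<and> e B \<in> Hom D (?o (g B)) B \<and> e' B \<in> Hom D B (?o (g B)) \<and>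
      Comp D (?o (g B)) B (?o (g B)) (e' B) (e B) = Id D (?o (g B)) \<and> Comp D B (?o (g B)) B (e B) (e' B) = Id D B"
    by metis
  have g: "g B \<in> Obj C" and e: "e B \<in> Hom D (?o (g B)) B" and e': "e' B \<in> Hom D B (?o (g B))"
    and e'e: "Comp D (?o (g B)) B (?o (g B)) (e' B) (e B) = Id D (?o (g B))"
    and ee': "Comp D B (?o (g B)) B (e B) (e' B) = Id D B"
    and Fg: "?o (g B) \<in> Obj D" if "B \<in> Obj D" for B
    using gee[OF that] Fo by auto
  \<comment> \<open>The conjugate of \<open>h\<close> by the chosen isomorphisms.\<close>
  define conj where "conj A B h = Comp D (?o (g A)) B (?o (g B)) (e' B) (Comp D (?o (g A)) A B h (e A))" for A B h
  have conj: "conj A B h \<in> Hom D (?o (g A)) (?o (g B))" if "A \<in> Obj D" "B \<in> Obj D" "h \<in> Hom D A B" for A B h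
    unfolding conj_def using that by (intro D.Comp_in_Hom) (simp_all add: Fg e e')
  have e_conj: "Comp D (?o (g A)) (?o (g B)) B (e B) (conj A B h) = Comp D (?o (g A)) A B h (e A)"
    if AB: "A \<in> Obj D" "B \<in> Obj D" "h \<in> Hom D A B" for A B h
  proof -
    have he: "Comp D (?o (g A)) A B h (e A) \<in> Hom D (?o (g A)) B"
      using AB by (intro D.Comp_in_Hom) (simp_all add: Fg e)
    have "Comp D (?o (g A)) (?o (g B)) B (e B) (conj A B h)
      = Comp D (?o (g A)) B B (Comp D B (?o (g B)) B (e B) (e' B)) (Comp D (?o (g A)) A B h (e A))"
      unfolding conj_def by (rule D.Comp_assoc) (simp_all add: AB Fg e e' he)
    then show ?thesis using AB he by (simp add: ee' D.Comp_Id_left Fg)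
  qed
  have conj_Comp: "conj A X (Comp D A B X k h) = Comp D (?o (g A)) (?o (g B)) (?o (g X)) (conj B X k) (conj A B h)"
    if AB: "A \<in> Obj D" "B \<in> Obj D" "X \<in> Obj D" "h \<in> Hom D A B" "k \<in> Hom D B X" for A B X h k
  proof -
    have he: "Comp D (?o (g A)) A B h (e A) \<in> Hom D (?o (g A)) B"
      and ke: "Comp D (?o (g B)) B X k (e B) \<in> Hom D (?o (g B)) X"
      using AB by (intro D.Comp_in_Hom; simp add: Fg e)+
    have "Comp D (?o (g A)) (?o (g B)) (?o (g X)) (conj B X k) (conj A B h)
      = Comp D (?o (g A)) X (?o (g X)) (e' X) (Comp D (?o (g A)) (?o (g B)) X (Comp D (?o (g B)) B X k (e B)) (conj A B h))"
      unfolding conj_def[of B] by (rule D.Comp_assoc[symmetric]) (simp_all add: AB Fg e e' ke conj)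
    also have "Comp D (?o (g A)) (?o (g B)) X (Comp D (?o (g B)) B X k (e B)) (conj A B h)
      = Comp D (?o (g A)) B X k (Comp D (?o (g A)) (?o (g B)) B (e B) (conj A B h))"
      by (rule D.Comp_assoc[symmetric]) (simp_all add: AB Fg e conj)
    also have "\<dots> = Comp D (?o (g A)) B X k (Comp D (?o (g A)) A B h (e A))"
      using AB by (simp add: e_conj)
    also have "\<dots> = Comp D (?o (g A)) A X (Comp D A B X k h) (e A)"
      by (rule D.Comp_assoc) (simp_all add: AB Fg e)
    finally show ?thesis by (simp add: conj_def)
  qed
  have conj_Id: "conj A A (Id D A) = Id D (?o (g A))" if "A \<in> Obj D" for A
    using that by (simp add: conj_def D.Comp_Id_left Fg e e'e)
  define G where "G = \<lparr>fobj = g, fmor = (\<lambda>A B h. lift (g A) (g B) (conj A B h))\<rparr>"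
  have Gm: "lift (g A) (g B) (conj A B h) \<in> Hom C (g A) (g B)" "?m (g A) (g B) (lift (g A) (g B) (conj A B h)) = conj A B h"
    if "A \<in> Obj D" "B \<in> Obj D" "h \<in> Hom D A B" for A B h
    using lift[OF g g conj] that by simp_all
  have G: "is_functor D C G"
    unfolding is_functor_def
  proof (intro conjI ballI)
    fix A assume A: "A \<in> Obj D"
    show "fobj G A \<in> Obj C" using A g by (simp add: G_def)
    show "fmor G A A (Id D A) = Id C (fobj G A)"
      using A Gm[OF A A D.Id_in_Hom[OF A]] unfolding G_def
      by (intro faithful[of "g A" "g A"]) (simp_all add: g C.Id_in_Hom conj_Id FId)
  next
    fix A B h assume "A \<in> Obj D" "B \<in> Obj D" "h \<in> Hom D A B"
    then show "fmor G A B h \<in> Hom C (fobj G A) (fobj G B)" using Gm by (simp add: G_def)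
  next
    fix A B X h k assume *: "A \<in> Obj D" "B \<in> Obj D" "X \<in> Obj D" "h \<in> Hom D A B" "k \<in> Hom D B X"
    then have kh: "Comp D A B X k h \<in> Hom D A X" by (intro D.Comp_in_Hom)
    show "fmor G A X (Comp D A B X k h) = Comp C (fobj G A) (fobj G B) (fobj G X) (fmor G B X k) (fmor G A B h)"
      unfolding G_def using * Gm[OF *(1,3) kh]
      by (intro faithful[of "g A" "g X"])
        (simp_all add: g Gm conj_Comp FComp C.Comp_in_Hom[of "g A" "g B" "g X"])
  qed
  have FG: "naturally_isomorphic D D (comp_func F G) id_func"
    unfolding naturally_isomorphic_def
  proof (intro exI[of _ e] conjI ballI)
    fix A assume "A \<in> Obj D"
    then show "e A \<in> isomorphisms D (fobj (comp_func F G) A) (fobj id_func A)"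
      by (intro isomorphismsI[of _ _ _ _ "e' A"]) (simp_all add: comp_func_def id_func_def G_def e e' e'e ee')
  next
    fix A B h assume "A \<in> Obj D" "B \<in> Obj D" "h \<in> Hom D A B"
    then show "Comp D (fobj (comp_func F G) A) (fobj (comp_func F G) B) (fobj id_func B) (e B) (fmor (comp_func F G) A B h)
      = Comp D (fobj (comp_func F G) A) (fobj id_func A) (fobj id_func B) (fmor id_func A B h) (e A)"
      by (simp add: comp_func_def id_func_def G_def Gm e_conj)
  qed
  have GF: "naturally_isomorphic C C (comp_func G F) id_func"
    unfolding naturally_isomorphic_def
  proof (intro exI[of _ "\<lambda>X. lift (g (?o X)) X (e (?o X))"] conjI ballI)
    fix X assume X: "X \<in> Obj C"
    let ?B = "?o X"
    have B: "?B \<in> Obj D" using X Fo by blast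
    let ?h = "lift (g ?B) X (e ?B)" and ?k = "lift X (g ?B) (e' ?B)"
    have h: "?h \<in> Hom C (g ?B) X" "?m (g ?B) X ?h = e ?B" and k: "?k \<in> Hom C X (g ?B)" "?m X (g ?B) ?k = e' ?B"
      using lift X B g e e' by simp_all
    have "Comp C (g ?B) X (g ?B) ?k ?h = Id C (g ?B)"
      using X B h k
        by (intro faithful[of "g ?B" "g ?B"]) (simp_all add: g C.Comp_in_Hom[of _ X] C.Id_in_Hom FComp FId e'e)
    moreover have "Comp C X (g ?B) X ?h ?k = Id C X"
      using X B h k
        by (intro faithful[of X X]) (simp_all add: g C.Comp_in_Hom[of _ "g ?B"] C.Id_in_Hom FComp FId ee')
    ultimately show "?h \<in> isomorphisms C (fobj (comp_func G F) X) (fobj id_func X)"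
      using h k by (intro isomorphismsI[of _ _ _ _ ?k]) (simp_all add: comp_func_def id_func_def G_def)
  next
    fix X Y f assume X: "X \<in> Obj C" and Y: "Y \<in> Obj C" and f: "f \<in> Hom C X Y"
    note o = Fo[OF X] Fo[OF Y] and m = Fm[OF X Y f]
    note h = lift[OF g[OF o(1)] X e[OF o(1)]] lift[OF g[OF o(2)] Y e[OF o(2)]] and n = Gm[OF o m]
    show "Comp C (fobj (comp_func G F) X) (fobj (comp_func G F) Y) (fobj id_func Y)
          (lift (g (?o Y)) Y (e (?o Y))) (fmor (comp_func G F) X Y f)
      = Comp C (fobj (comp_func G F) X) (fobj id_func X) (fobj id_func Y) (fmor id_func X Y f) (lift (g (?o X)) X (e (?o X)))"
      unfolding comp_func_def id_func_def G_def using X Y f o m h n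
      by (intro faithful[of "g (?o X)" Y])
        (simp_all add: g C.Comp_in_Hom[of _ "g (?o Y)"] C.Comp_in_Hom[of _ X] FComp e_conj)
  qed
  show ?thesis unfolding equivalent_def using C D F G FG GF by blast
qed

section \<open>The duality\<close>

lemma open_perfect_map_cong:
  assumes "open_perfect_map X Y f" "\<And>x. x \<in> topspace X \<Longrightarrow> f x = g x"
  shows "open_perfect_map X Y g"
proof -
  have f: "continuous_map X Y f" "open_map X Y f" "closed_map X Y f" "\<forall>y\<in>topspace Y. compactin X {x \<in> topspace X. f x = y}"
    using assms(1) by (auto simp: open_perfect_map_def proper_map_def)
  have "{x \<in> topspace X. f x = y} = {x \<in> topspace X. g x = y}" for y using assms(2) by auto
  then have "proper_map X Y g" using f closed_map_eq[of X Y f g] assms(2) by (simp add: proper_map_def)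
  then show ?thesis
    using f assms(2) continuous_map_eq[of X Y f g] open_map_eq[of X Y f g]
      by (simp add: open_perfect_map_def)
qed

lemma open_perfect_map_id: "open_perfect_map X X (\<lambda>x. x)"
proof -
  have "homeomorphic_map X X (\<lambda>x. x)" using homeomorphic_map_id[of X X] unfolding id_def by blast
  then show ?thesis
    by (simp add: open_perfect_map_def homeomorphic_imp_continuous_map homeomorphic_imp_open_map homeomorphic_imp_proper_map)
qed

lemma open_perfect_map_compose:
  "\<lbrakk>open_perfect_map X Y f; open_perfect_map Y Z g\<rbrakk> \<Longrightarrow> open_perfect_map X Z (g \<circ> f)"
  unfolding open_perfect_map_def by (meson continuous_map_compose open_map_compose proper_map_compose)

lemma OpPerLC_simps:
  "Obj (OpPerLC \<U>) = {X. topspace X \<in> \<U> \<and> locally_compact_space X \<and> Hausdorff_space X}"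
  "Hom (OpPerLC \<U>) X Y = {f \<in> extensional (topspace X). open_perfect_map X Y f}"
  "cat.Id (OpPerLC \<U>) X = restrict (\<lambda>x. x) (topspace X)"
  "Comp (OpPerLC \<U>) X Y Z g f = compose (topspace X) g f"
  by (simp_all add: OpPerLC_def)

lemma DOpPerLC_simps:
  "Obj (DOpPerLC \<U>) = {A. carrier A \<in> \<U> \<and> complete_local_contact_algebra A}"
  "Hom (DOpPerLC \<U>) A B = {\<phi> \<in> extensional (carrier A). DOpPerLC_morphism A B \<phi>}"
  "cat.Id (DOpPerLC \<U>) A = restrict (\<lambda>x. x) (carrier A)"
  "Comp (DOpPerLC \<U>) A B D \<psi> \<phi> = compose (carrier A) \<psi> \<phi>"
  by (simp_all add: DOpPerLC_def)

lemma open_perfect_map_funcset: "open_perfect_map X Y f \<Longrightarrow> f \<in> topspace X \<rightarrow> topspace Y"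
  by (auto simp: open_perfect_map_def continuous_map_def)

lemma DOpPerLC_morphism_funcset: "DOpPerLC_morphism A B \<phi> \<Longrightarrow> \<phi> \<in> carrier A \<rightarrow> carrier B"
  by (auto simp: DOpPerLC_morphism_def complete_boolean_hom_def)

lemma restrict_Id_open_perfect_map: "open_perfect_map X X (restrict (\<lambda>x. x) (topspace X))"
  by (rule open_perfect_map_cong[OF open_perfect_map_id]) simp

lemma compose_open_perfect_map:
  "\<lbrakk>open_perfect_map X Y f; open_perfect_map Y Z g\<rbrakk> \<Longrightarrow> open_perfect_map X Z (compose (topspace X) g f)"
  by (rule open_perfect_map_cong[of X Z "g \<circ> f"]) (simp_all add: open_perfect_map_compose compose_def)

lemma category_OpPerLC: "category (OpPerLC UNIV\<lparr>Obj := \<X>\<rparr>)"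
proof
  fix W X Y Z f g h assume "f \<in> Hom (OpPerLC UNIV\<lparr>Obj := \<X>\<rparr>) W X"
  then have "f \<in> topspace W \<rightarrow> topspace X" using open_perfect_map_funcset[of W X f]
    by (simp add: OpPerLC_simps)
  then show "Comp (OpPerLC UNIV\<lparr>Obj := \<X>\<rparr>) W Y Z h (Comp (OpPerLC UNIV\<lparr>Obj := \<X>\<rparr>) W X Y g f) =
      Comp (OpPerLC UNIV\<lparr>Obj := \<X>\<rparr>) W X Z (Comp (OpPerLC UNIV\<lparr>Obj := \<X>\<rparr>) X Y Z h g) f"
    by (simp add: OpPerLC_simps compose_assoc)
next
  fix X Y f assume "f \<in> Hom (OpPerLC UNIV\<lparr>Obj := \<X>\<rparr>) X Y"
  then have "f \<in> topspace X \<rightarrow> topspace Y" "f \<in> extensional (topspace X)"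
    using open_perfect_map_funcset[of X Y f] by (simp_all add: OpPerLC_simps)
  then show "Comp (OpPerLC UNIV\<lparr>Obj := \<X>\<rparr>) X X Y f (cat.Id (OpPerLC UNIV\<lparr>Obj := \<X>\<rparr>) X) = f"
    and "Comp (OpPerLC UNIV\<lparr>Obj := \<X>\<rparr>) X Y Y (cat.Id (OpPerLC UNIV\<lparr>Obj := \<X>\<rparr>) Y) f = f"
    by (simp_all add: OpPerLC_simps compose_Id Id_compose)
qed (auto simp: OpPerLC_simps restrict_Id_open_perfect_map compose_open_perfect_map)

context representation_pair
begin

lemma dual_map_extensional: "dual_map f \<in> extensional (carrier B)"
  by (simp add: dual_map_def)

lemma dual_map_eqI:
  assumes "open_perfect_map X Y f" "\<phi> \<in> extensional (carrier B)"
    and "\<And>b. b \<in> carrier B \<Longrightarrow> \<phi> b \<in> carrier A"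
    and "\<And>b. b \<in> carrier B \<Longrightarrow> s (\<phi> b) = {x \<in> topspace X. f x \<in> t b}"
  shows "dual_map f = \<phi>"
proof (rule extensionalityI[OF dual_map_extensional assms(2)])
  fix b assume b: "b \<in> carrier B"
  then have "s (dual_map f b) = s (\<phi> b)" using assms by (simp add: s_dual_map)
  then show "dual_map f b = \<phi> b" using X.s_eq_iff dual_map_closed[OF assms(1) b] assms(3)[OF b] by blast
qed

text \<open>The functor is full and faithful: the point map of a morphism is a preimage, and two
  preimages agree because regular closed sets separate points.\<close>
theorem dual_map_bij_betw:
  "bij_betw dual_map {f \<in> extensional (topspace X). open_perfect_map X Y f}
     {\<phi> \<in> extensional (carrier B). DOpPerLC_morphism B A \<phi>}"
  unfolding bij_betw_def
proof
  show "inj_on dual_map {f \<in> extensional (topspace X). open_perfect_map X Y f}"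
  proof (rule inj_onI)
    fix f g assume "f \<in> {f \<in> extensional (topspace X). open_perfect_map X Y f}"
      and "g \<in> {f \<in> extensional (topspace X). open_perfect_map X Y f}" and "dual_map f = dual_map g"
    then show "f = g" using dual_map_inject by (auto intro: extensionalityI[of _ "topspace X"])
  qed
  show "dual_map ` {f \<in> extensional (topspace X). open_perfect_map X Y f} =
      {\<phi> \<in> extensional (carrier B). DOpPerLC_morphism B A \<phi>}" (is "?L = ?R")
  proof
    show "?L \<subseteq> ?R" using DOpPerLC_morphism_dual_map dual_map_extensional by blast
    show "?R \<subseteq> ?L"
    proof
      fix \<phi> assume "\<phi> \<in> ?R"
      then have \<phi>: "\<phi> \<in> extensional (carrier B)" "DOpPerLC_morphism B A \<phi>" by auto
      let ?f = "restrict (point_map \<phi>) (topspace X)"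
      have f: "open_perfect_map X Y ?f"
        by (rule open_perfect_map_cong[OF open_perfect_point_map[OF \<phi>(2)]]) simp
      have "dual_map ?f = \<phi>"
      proof (rule dual_map_eqI[OF f \<phi>(1)])
        fix b assume b: "b \<in> carrier B"
        show "\<phi> b \<in> carrier A" using \<phi>_closed[OF \<phi>(2) b] .
        show "s (\<phi> b) = {x \<in> topspace X. ?f x \<in> t b}"
          using point_map_iff[OF \<phi>(2) _ b] X.s_subset_topspace[OF \<phi>_closed[OF \<phi>(2) b]] by auto
      qed
      then show "\<phi> \<in> ?L" using f by (intro image_eqI[of _ _ ?f]) auto
    qed
  qed
qed

end

lemma dual_map_Id:
  assumes "regular_closed_representation X A s"
  shows "representation_pair.dual_map X A s A s (restrict (\<lambda>x. x) (topspace X)) = restrict (\<lambda>a. a) (carrier A)"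
proof -
  interpret regular_closed_representation X A s by fact
  interpret pair: representation_pair X A s X A s ..
  show ?thesis
    using s_subset_topspace by (intro pair.dual_map_eqI restrict_Id_open_perfect_map) auto
qed

text \<open>The three representations are independent of each other. For identity maps of one space,
  this yields the isomorphism between any two algebras that it represents.\<close>
lemma dual_map_compose:
  assumes X: "regular_closed_representation X A s" and Y: "regular_closed_representation Y B t"
    and Z: "regular_closed_representation Z D r"
    and f: "open_perfect_map X Y f" and g: "open_perfect_map Y Z g"
  shows "representation_pair.dual_map X A s D r (compose (topspace X) g f) =
    compose (carrier D) (representation_pair.dual_map X A s B t f) (representation_pair.dual_map Y B t D r g)"
proof -
  interpret XY: representation_pair X A s Y B t using X Y by (rule representation_pair.intro)
  interpret YZ: representation_pair Y B t Z D r using Y Z by (rule representation_pair.intro)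
  interpret XZ: representation_pair X A s Z D r using X Z by (rule representation_pair.intro)
  show ?thesis
  proof (rule XZ.dual_map_eqI[OF compose_open_perfect_map[OF f g]])
    fix d assume d: "d \<in> carrier D"
    show "compose (carrier D) (XY.dual_map f) (YZ.dual_map g) d \<in> carrier A"
      using d f g by (simp add: compose_def XY.dual_map_closed YZ.dual_map_closed)
    show "s (compose (carrier D) (XY.dual_map f) (YZ.dual_map g) d) =
        {x \<in> topspace X. compose (topspace X) g f x \<in> r d}"
      using d f g open_perfect_map_funcset[OF f]
      by (auto simp: compose_def XY.s_dual_map YZ.s_dual_map YZ.dual_map_closed)
  qed simp
qed

text \<open>Since every algebra considered is represented by a space, its morphisms are duals of maps;
  even the closure of these morphisms under composition is inherited from the maps.\<close>
theorem dually_equivalent_if_representable: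
  fixes \<X> :: "'p topology set" and \<A> :: "'e local_contact_structure set"
  assumes XA: "\<And>X. X \<in> \<X> \<Longrightarrow> \<exists>A\<in>\<A>. \<exists>s. regular_closed_representation X A s"
    and AX: "\<And>A. A \<in> \<A> \<Longrightarrow> \<exists>X\<in>\<X>. \<exists>s. regular_closed_representation X A s"
  shows "dually_equivalent (OpPerLC UNIV\<lparr>Obj := \<X>\<rparr>) (DOpPerLC UNIV\<lparr>Obj := \<A>\<rparr>)"
proof -
  let ?C = "OpPerLC UNIV\<lparr>Obj := \<X>\<rparr>" and ?D = "DOpPerLC UNIV\<lparr>Obj := \<A>\<rparr>"
  let ?dual = "representation_pair.dual_map"
  \<comment> \<open>The constant at the two types in question, so that their inference does not depend on each use.\<close>
  define rep where "rep = (regular_closed_representation :: 'p topology \<Rightarrow> 'e local_contact_structure \<Rightarrow> _)"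
  have pair: "representation_pair X A s Y B t" if "rep X A s" "rep Y B t" for X A s Y B t
    using that unfolding rep_def by (rule representation_pair.intro)
  have D_Hom: "Hom ?D B A = ?dual X A s B t ` Hom ?C X Y" if "rep X A s" "rep Y B t" for X A s Y B t
    using representation_pair.dual_map_bij_betw[OF pair[OF that]]
    by (simp add: OpPerLC_simps DOpPerLC_simps bij_betw_def)
  have D: "category ?D"
  proof
    fix A assume "A \<in> Obj ?D"
    then obtain X s where r: "rep X A s" using AX[of A] by (auto simp: rep_def)
    have "cat.Id ?D A = ?dual X A s A s (cat.Id ?C X)"
      using dual_map_Id[of X A s] r by (simp add: OpPerLC_simps DOpPerLC_simps rep_def)
    then show "cat.Id ?D A \<in> Hom ?D A A"
      using D_Hom[OF r r] restrict_Id_open_perfect_map[of X]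
      by (simp add: OpPerLC_simps)
  next
    fix A B E \<phi> \<psi>
    assume "A \<in> Obj ?D" "B \<in> Obj ?D" "E \<in> Obj ?D" and \<phi>: "\<phi> \<in> Hom ?D A B" and \<psi>: "\<psi> \<in> Hom ?D B E"
    then obtain X s Y t Z r where rs: "rep X A s" "rep Y B t" "rep Z E r"
      using AX[of A] AX[of B] AX[of E] unfolding rep_def by auto
    obtain f where f: "f \<in> Hom ?C Y X" "\<phi> = ?dual Y B t A s f" using \<phi> D_Hom[OF rs(2,1)] by auto
    obtain g where g: "g \<in> Hom ?C Z Y" "\<psi> = ?dual Z E r B t g" using \<psi> D_Hom[OF rs(3,2)] by auto
    have "Comp ?D A B E \<psi> \<phi> = ?dual Z E r A s (compose (topspace Z) f g)"
      using dual_map_compose[of Z E r Y B t X A s g f] rs f g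
      by (simp add: OpPerLC_simps DOpPerLC_simps rep_def)
    moreover have "compose (topspace Z) f g \<in> Hom ?C Z X"
      using f(1) g(1) compose_open_perfect_map[of Z Y g X f] by (simp add: OpPerLC_simps)
    ultimately show "Comp ?D A B E \<psi> \<phi> \<in> Hom ?D A E"
      unfolding D_Hom[OF rs(3,1)] by blast
  next
    fix A B \<phi> assume "\<phi> \<in> Hom ?D A B"
    then have "\<phi> \<in> carrier A \<rightarrow> carrier B" "\<phi> \<in> extensional (carrier A)"
      using DOpPerLC_morphism_funcset[of A B \<phi>] by (simp_all add: DOpPerLC_simps)
    then show "Comp ?D A A B \<phi> (cat.Id ?D A) = \<phi>" "Comp ?D A B B (cat.Id ?D B) \<phi> = \<phi>"
      by (simp_all add: DOpPerLC_simps compose_Id Id_compose)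
  next
    fix A B E G \<phi> \<psi> \<xi> assume "\<phi> \<in> Hom ?D A B"
    then have "\<phi> \<in> carrier A \<rightarrow> carrier B" using DOpPerLC_morphism_funcset[of A B \<phi>]
      by (simp add: DOpPerLC_simps)
    then show "Comp ?D A E G \<xi> (Comp ?D A B E \<psi> \<phi>) = Comp ?D A B G (Comp ?D B E G \<xi> \<psi>) \<phi>"
      by (simp add: DOpPerLC_simps compose_assoc)
  qed
  have "\<forall>X\<in>\<X>. \<exists>A s. A \<in> \<A> \<and> rep X A s" using XA unfolding rep_def by blast
  then obtain a s where as: "\<And>X. X \<in> \<X> \<Longrightarrow> a X \<in> \<A> \<and> rep X (a X) (s X)" by metis
  define F where "F = \<lparr>fobj = a, fmor = (\<lambda>X Y. ?dual X (a X) (s X) (a Y) (s Y))\<rparr>"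
  have F: "is_functor ?C (opposite ?D) F"
    unfolding is_functor_def
  proof (intro conjI ballI)
    fix X assume "X \<in> Obj ?C"
    then have X: "X \<in> \<X>" by simp
    then show "fobj F X \<in> Obj (opposite ?D)" using as by (simp add: F_def opposite_def)
    show "fmor F X X (cat.Id ?C X) = cat.Id (opposite ?D) (fobj F X)"
      using dual_map_Id[of X "a X" "s X"] as[OF X]
        by (simp add: F_def opposite_def OpPerLC_simps DOpPerLC_simps rep_def)
  next
    fix X Y f assume "X \<in> Obj ?C" "Y \<in> Obj ?C" and f: "f \<in> Hom ?C X Y"
    then have "rep X (a X) (s X)" "rep Y (a Y) (s Y)" using as by simp_all
    then show "fmor F X Y f \<in> Hom (opposite ?D) (fobj F X) (fobj F Y)"
      using D_Hom f unfolding F_def opposite_def by auto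
  next
    fix X Y Z f g assume "X \<in> Obj ?C" "Y \<in> Obj ?C" "Z \<in> Obj ?C" and fg: "f \<in> Hom ?C X Y" "g \<in> Hom ?C Y Z"
    then have "rep X (a X) (s X)" "rep Y (a Y) (s Y)" "rep Z (a Z) (s Z)" using as by simp_all
    then show "fmor F X Z (Comp ?C X Y Z g f) = Comp (opposite ?D) (fobj F X) (fobj F Y) (fobj F Z) (fmor F Y Z g) (fmor F X Y f)"
      using fg dual_map_compose[of X "a X" "s X" Y "a Y" "s Y" Z "a Z" "s Z" f g] unfolding rep_def
        by (simp add: F_def opposite_def OpPerLC_simps DOpPerLC_simps)
  qed
  have "equivalent ?C (opposite ?D)"
  proof (rule equivalent_if_fully_faithful_essentially_surjective[OF category_OpPerLC category_opposite[OF D] F])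
    fix X Y assume "X \<in> Obj ?C" "Y \<in> Obj ?C"
    then have "rep X (a X) (s X)" "rep Y (a Y) (s Y)" using as by simp_all
    from representation_pair.dual_map_bij_betw[OF pair[OF this]]
    show "bij_betw (fmor F X Y) (Hom ?C X Y) (Hom (opposite ?D) (fobj F X) (fobj F Y))"
      by (simp add: F_def opposite_def OpPerLC_simps DOpPerLC_simps)
  next
    fix A assume "A \<in> Obj (opposite ?D)"
    then obtain X t where X: "X \<in> \<X>" and t: "rep X A t" using AX[of A]
      by (auto simp: opposite_def rep_def)
    have aX: "rep X (a X) (s X)" using as X by blast
    \<comment> \<open>The identity of \<open>X\<close>, seen as a map between two representations of algebras on \<open>X\<close>, induces
      an isomorphism of these algebras.\<close>
    let ?i = "cat.Id ?C X"
    have i: "?i \<in> Hom ?C X X" "compose (topspace X) ?i ?i = ?i" "open_perfect_map X X ?i"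
      by (auto simp: OpPerLC_simps restrict_Id_open_perfect_map compose_def)
    let ?f = "?dual X (a X) (s X) A t ?i" and ?g = "?dual X A t (a X) (s X) ?i"
    have "?f \<in> isomorphisms (opposite ?D) (a X) A"
    proof (rule isomorphismsI[of _ _ _ _ ?g])
      show "?f \<in> Hom (opposite ?D) (a X) A" "?g \<in> Hom (opposite ?D) A (a X)"
        using D_Hom[OF aX t] D_Hom[OF t aX] i by (auto simp: opposite_def)
      have "compose (carrier (a X)) ?f ?g = ?dual X (a X) (s X) (a X) (s X) ?i"
        using dual_map_compose[of X "a X" "s X" X A t X "a X" "s X" ?i ?i] aX t i by (simp add: rep_def)
      then show "Comp (opposite ?D) (a X) A (a X) ?g ?f = cat.Id (opposite ?D) (a X)"
        using dual_map_Id[of X "a X" "s X"] aX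
          by (simp add: opposite_def OpPerLC_simps DOpPerLC_simps rep_def)
      have "compose (carrier A) ?g ?f = ?dual X A t A t ?i"
        using dual_map_compose[of X A t X "a X" "s X" X A t ?i ?i] aX t i by (simp add: rep_def)
      then show "Comp (opposite ?D) A (a X) A ?f ?g = cat.Id (opposite ?D) A"
        using dual_map_Id[of X A t] t by (simp add: opposite_def OpPerLC_simps DOpPerLC_simps rep_def)
    qed
    then show "\<exists>X\<in>Obj ?C. isomorphisms (opposite ?D) (fobj F X) A \<noteq> {}"
      using X by (auto simp: F_def)
  qed
  then show ?thesis by (simp add: dually_equivalent_def)
qed

text \<open>Transport of the algebra of regular closed sets along an injection into \<open>Q\<close>.\<close>
lemma regular_closed_algebra_exists:
  fixes X :: "'p topology"
  assumes X: "locally_compact_space X" "Hausdorff_space X" and Q: "{F. regular_closed X F} \<lesssim> (Q :: 'e set)"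
  obtains A :: "'e local_contact_structure" and s where "regular_closed_representation X A s" "carrier A \<subseteq> Q"
proof -
  obtain i where i: "inj_on i {F. regular_closed X F}" "i ` {F. regular_closed X F} \<subseteq> Q"
    using Q by (auto simp: lepoll_def)
  define s where "s = inv_into {F. regular_closed X F} i"
  define K where "K = i ` {F. regular_closed X F}"
  define A where "A = \<lparr>carrier = K, eq = ((=) :: 'e \<Rightarrow> 'e \<Rightarrow> bool), le = (\<lambda>a b. s a \<subseteq> s b), contact = (\<lambda>a b. s a \<inter> s b \<noteq> {}),
    bounded_elems = {a \<in> K. compactin X (s a)}\<rparr>"
  have "bij_betw s K {F. regular_closed X F}"
    unfolding s_def K_def by (rule bij_betw_inv_into[OF inj_on_imp_bij_betw[OF i(1)]])
  then have "regular_closed_representation X A s"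
    by unfold_locales (simp_all add: A_def X)
  then show thesis using that[of A s] i(2) by (simp add: A_def K_def)
qed

text \<open>For a universe, all spaces and all algebras in it are taken; closure under power sets
  provides room for the dual objects. For arbitrary types, the spaces are those whose regular
  closed sets fit into the type of algebra elements, and the algebras are those represented by
  such a space.\<close>
theorem theorem2p21:
  fixes \<U> :: "'u set set"
  shows
    "(small_universe \<U> \<longrightarrow> dually_equivalent (OpPerLC \<U>) (DOpPerLC \<U>)) \<and>
     (\<exists>(\<X> :: 'p topology set) (\<A> :: 'e local_contact_structure set).
        (\<forall>X \<in> Obj (OpPerLC UNIV). Pow (topspace X) \<lesssim> (UNIV :: 'e set) \<longrightarrow> X \<in> \<X>) \<and>
        (\<forall>A \<in> Obj (DOpPerLC UNIV). Pow (carrier A) \<lesssim> (UNIV :: 'p set) \<longrightarrow> A \<in> \<A>) \<and>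
        dually_equivalent (full_subcategory (OpPerLC UNIV) \<X>)
                          (full_subcategory (DOpPerLC UNIV) \<A>))"
proof (intro conjI impI)
  assume \<U>: "small_universe \<U>"
  have sub: "K \<in> \<U>" if "K \<subseteq> Q" "Q \<in> \<U>" for K Q
    using \<U> subset_imp_lepoll[OF that(1)] that(2) unfolding small_universe_def by blast
  have pow: "\<exists>Q\<in>\<U>. Pow K \<lesssim> Q" if "K \<in> \<U>" for K using \<U> that unfolding small_universe_def by blast
  have "dually_equivalent (OpPerLC UNIV\<lparr>Obj := Obj (OpPerLC \<U>)\<rparr>) (DOpPerLC UNIV\<lparr>Obj := Obj (DOpPerLC \<U>)\<rparr>)"
  proof (rule dually_equivalent_if_representable)
    fix X assume "X \<in> Obj (OpPerLC \<U>)"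
    then have X: "topspace X \<in> \<U>" "locally_compact_space X" "Hausdorff_space X"
      by (auto simp: OpPerLC_simps)
    obtain Q where Q: "Q \<in> \<U>" "Pow (topspace X) \<lesssim> Q" using pow X by blast
    have "{F. regular_closed X F} \<subseteq> Pow (topspace X)" using regular_closed_subset by blast
    then have "{F. regular_closed X F} \<lesssim> Q" using Q(2) subset_imp_lepoll lepoll_trans by blast
    then obtain A s where A: "regular_closed_representation X A s" "carrier A \<subseteq> Q"
      using regular_closed_algebra_exists[OF X(2,3)] by blast
    then have "A \<in> Obj (DOpPerLC \<U>)"
      using sub Q regular_closed_representation.complete_local_contact_algebra_A
        by (auto simp: DOpPerLC_simps)
    then show "\<exists>A\<in>Obj (DOpPerLC \<U>). \<exists>s. regular_closed_representation X A s" using A by blast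
  next
    fix A assume "A \<in> Obj (DOpPerLC \<U>)"
    then have A: "carrier A \<in> \<U>" "complete_local_contact_algebra A" by (auto simp: DOpPerLC_simps)
    obtain Q where Q: "Q \<in> \<U>" "Pow (carrier A) \<lesssim> Q" using pow A by blast
    then obtain X s where X: "regular_closed_representation X A s" "topspace X \<subseteq> Q"
      using complete_local_contact_algebra_representable[OF A(2)] by blast
    then have "X \<in> Obj (OpPerLC \<U>)"
      using sub Q regular_closed_representation.locally_compact[OF X(1)] regular_closed_representation.Hausdorff[OF X(1)]
      by (auto simp: OpPerLC_simps)
    then show "\<exists>X\<in>Obj (OpPerLC \<U>). \<exists>s. regular_closed_representation X A s" using X by blast
  qed
  then show "dually_equivalent (OpPerLC \<U>) (DOpPerLC \<U>)" by (simp add: OpPerLC_def DOpPerLC_def)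
next
  let ?UE = "UNIV :: 'e set" and ?UP = "UNIV :: 'p set"
  define \<X> :: "'p topology set" where
    "\<X> = {X. locally_compact_space X \<and> Hausdorff_space X \<and> {F. regular_closed X F} \<lesssim> ?UE}"
  define \<A> :: "'e local_contact_structure set" where
    "\<A> = {A. \<exists>X\<in>\<X>. \<exists>s. regular_closed_representation X A s}"
  have \<X>_Obj: "\<X> \<subseteq> Obj (OpPerLC UNIV)" by (auto simp: \<X>_def OpPerLC_simps)
  have \<A>_Obj: "\<A> \<subseteq> Obj (DOpPerLC UNIV)"
    using regular_closed_representation.complete_local_contact_algebra_A
      by (auto simp: \<A>_def DOpPerLC_simps)
  have "dually_equivalent (OpPerLC UNIV\<lparr>Obj := \<X>\<rparr>) (DOpPerLC UNIV\<lparr>Obj := \<A>\<rparr>)"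
  proof (rule dually_equivalent_if_representable)
    fix X assume X: "X \<in> \<X>"
    then obtain A :: "'e local_contact_structure" and s where "regular_closed_representation X A s"
      using regular_closed_algebra_exists[of X ?UE] by (auto simp: \<X>_def)
    then show "\<exists>A\<in>\<A>. \<exists>s. regular_closed_representation X A s" using X by (auto simp: \<A>_def)
  qed (auto simp: \<A>_def)
  then have "dually_equivalent (full_subcategory (OpPerLC UNIV) \<X>) (full_subcategory (DOpPerLC UNIV) \<A>)"
    using \<X>_Obj \<A>_Obj by (simp add: full_subcategory_def Int_absorb1)
  moreover have "X \<in> \<X>" if X: "X \<in> Obj (OpPerLC UNIV)" "Pow (topspace X) \<lesssim> ?UE" for X
  proof -
    have "{F. regular_closed X F} \<subseteq> Pow (topspace X)" using regular_closed_subset by blast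
    then have "{F. regular_closed X F} \<lesssim> ?UE" using X(2) subset_imp_lepoll lepoll_trans by blast
    then show ?thesis using X by (simp add: \<X>_def OpPerLC_simps)
  qed
  moreover have "A \<in> \<A>" if A: "A \<in> Obj (DOpPerLC UNIV)" "Pow (carrier A) \<lesssim> ?UP" for A
  proof -
    obtain X :: "'p topology" and s where X: "regular_closed_representation X A s"
      using complete_local_contact_algebra_representable[of A ?UP] A by (auto simp: DOpPerLC_simps)
    interpret regular_closed_representation X A s by fact
    have "{F. regular_closed X F} \<lesssim> ?UE"
      using bij_betw_inv_into[OF bij] unfolding lepoll_def bij_betw_def by blast
    then show ?thesis using X locally_compact Hausdorff by (auto simp: \<A>_def \<X>_def)
  qed
  ultimately show "\<exists>(\<X> :: 'p topology set) (\<A> :: 'e local_contact_structure set).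
        (\<forall>X \<in> Obj (OpPerLC UNIV). Pow (topspace X) \<lesssim> ?UE \<longrightarrow> X \<in> \<X>) \<and>
        (\<forall>A \<in> Obj (DOpPerLC UNIV). Pow (carrier A) \<lesssim> ?UP \<longrightarrow> A \<in> \<A>) \<and>
        dually_equivalent (full_subcategory (OpPerLC UNIV) \<X>) (full_subcategory (DOpPerLC UNIV) \<A>)"
    by (intro exI[of _ \<X>] exI[of _ \<A>]) blast
qed

end
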